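(* Let $\mathcal{C}$ be the space of smooth, simple, closed and strictly convex curves in the Minkowski plane with unit ball $\mathcal{P}$, endowed with the Hausdorff topology. There exists a non-negative, continuous, scale-invariant functional $F:\mathcal{C}\rightarrow\mathbb{R}$ such that for every $\gamma\in\mathcal{C}$ $$\left(1-F(\gamma)\right)\int_{0}^{L_{\mathcal{Q}}}k^{2}\,ds-A(\mathcal{P})\frac{L_{\mathcal{Q}}}{A}\geq 0,$$ where $A$, $L_{\mathcal{Q}}$ and $k$ are the enclosed (usual) area, the $\mathcal{Q}$-length and the Minkowskian curvature of $\gamma$. Moreover, $F(\gamma)=0$ if and only if $\gamma$ is a $\mathcal{P}$-circle.
   Context: $[\cdot,\cdot]$ denotes the determinant of two vectors of $\mathbb{R}^2$; $e_r=(\cos\theta,\sin\theta)$, $e_\theta=(-\sin\theta,\cos\theta)$; a prime denotes $d/d\theta$. $\mathcal{P}\subset\mathbb{R}^2$ is a strictly convex set, symmetric with respect to the origin, whose boundary is a $C^\infty$ curve $p(\theta)=a(\theta)e_r+a'(\theta)e_\theta$, $0\le\theta\le 2\pi$, where $a$ is the support function of $\mathcal{P}$; so $p'=(a+a'')e_\theta$ and $[p,p']=a(a+a'')$. It is assumed that $a+a''>0$ for all $\theta$. $\mathcal{P}$ is the unit ball of the Minkowski norm, $A(\mathcal{P})$ is its usual area, and a $\mathcal{P}$-circle is a curve of the form $x+r\,\partial\mathcal{P}$ with $x\in\mathbb{R}^2$, $r>0$. The dual unit ball is identified with the convex set $\mathcal{Q}$ with boundary $q(\theta)=p'(\theta)/[p(\theta),p'(\theta)]=\frac{1}{a(\theta)}e_\theta$.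 A closed strictly convex curve $\gamma$ is parameterized by $\theta$ so that $\gamma'(\theta)=\lambda(\theta)q(\theta)$ with $\lambda>0$; its $\mathcal{Q}$-length is $L_{\mathcal{Q}}=\int_0^{2\pi}\lambda\,d\theta$, its $\mathcal{Q}$-arclength element is $ds=\lambda\,d\theta$, and its Minkowskian curvature is $k(\theta)=[p,p']/\lambda(\theta)$. Scale-invariant means $F(c\gamma)=F(\gamma)$ for every $c>0$. *)

theory Defs
  imports "HOL-Analysis.Analysis"
begin

definition bracket :: "real^2 \<Rightarrow> real^2 \<Rightarrow> real" where
  "bracket u v = det (vector [u, v] :: real^2^2)"

definition e_r :: "real \<Rightarrow> real^2" where
  "e_r \<theta> = vector [cos \<theta>, sin \<theta>]"

definition e_th :: "real \<Rightarrow> real^2" where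
  "e_th \<theta> = vector [- sin \<theta>, cos \<theta>]"

definition smooth :: "(real \<Rightarrow> 'a::real_normed_vector) \<Rightarrow> bool" where
  "smooth f \<longleftrightarrow> (\<exists>D :: nat \<Rightarrow> real \<Rightarrow> 'a. D 0 = f \<and>
     (\<forall>n t. (D n has_vector_derivative D (Suc n) t) (at t)))"

definition strictly_convex :: "(real^2) set \<Rightarrow> bool" where
  "strictly_convex S \<longleftrightarrow> (\<forall>x\<in>S. \<forall>y\<in>S. x \<noteq> y \<longrightarrow> open_segment x y \<subseteq> interior S)"

definition support_fun :: "(real^2) set \<Rightarrow> real \<Rightarrow> real" where
  "support_fun P \<theta> = (SUP x\<in>P. x \<bullet> e_r \<theta>)"

definition ball_curve :: "(real^2) set \<Rightarrow> real \<Rightarrow> real^2" where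
  "ball_curve P \<theta> = support_fun P \<theta> *\<^sub>R e_r \<theta> + deriv (support_fun P) \<theta> *\<^sub>R e_th \<theta>"

definition ball_curve' :: "(real^2) set \<Rightarrow> real \<Rightarrow> real^2" where
  "ball_curve' P \<theta> = vector_derivative (ball_curve P) (at \<theta>)"

text \<open>Smoothness of the boundary curve entails smoothness of the support function, because the
  latter is the inner product of the curve with \<^term>\<open>e_r\<close>; so the two derivatives of the support
  function below are genuine.\<close>

definition minkowski_ball :: "(real^2) set \<Rightarrow> bool" where
  "minkowski_ball P \<longleftrightarrow>
     compact P \<and> interior P \<noteq> {} \<and> strictly_convex P \<and> (\<forall>x\<in>P. - x \<in> P) \<and>
     smooth (ball_curve P) \<and> frontier P = ball_curve P ` {0..2*pi} \<and>
     (\<forall>\<theta>. support_fun P \<theta> + deriv (deriv (support_fun P)) \<theta> > 0)"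

definition dual_curve :: "(real^2) set \<Rightarrow> real \<Rightarrow> real^2" where
  "dual_curve P \<theta> = ball_curve' P \<theta> /\<^sub>R bracket (ball_curve P \<theta>) (ball_curve' P \<theta>)"

definition P_circle :: "(real^2) set \<Rightarrow> (real^2) set \<Rightarrow> bool" where
  "P_circle P \<gamma> \<longleftrightarrow> (\<exists>x r. r > 0 \<and> \<gamma> = (\<lambda>y. x + r *\<^sub>R y) ` frontier P)"

text \<open>A curve is identified with its trace \<open>\<gamma>\<close>. The angle parametrization \<open>c\<close> below, and hence
  \<open>\<lambda>\<close>, is determined by \<open>\<gamma>\<close>, since \<open>c \<theta>\<close> is the point of \<open>\<gamma>\<close> with outer normal \<^term>\<open>e_r \<theta>\<close>.\<close>

definition angle_param ::
    "(real^2) set \<Rightarrow> (real^2) set \<Rightarrow> (real \<Rightarrow> real^2) \<Rightarrow> (real \<Rightarrow> real) \<Rightarrow> bool" where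
  "angle_param P \<gamma> c lam \<longleftrightarrow>
     smooth c \<and> (\<forall>\<theta>. c (\<theta> + 2*pi) = c \<theta>) \<and> inj_on c {0..<2*pi} \<and> c ` {0..2*pi} = \<gamma> \<and>
     (\<forall>\<theta>. lam \<theta> > 0 \<and> (c has_vector_derivative lam \<theta> *\<^sub>R dual_curve P \<theta>) (at \<theta>))"

definition curve_space :: "(real^2) set \<Rightarrow> (real^2) set set" where
  "curve_space P = {\<gamma>. strictly_convex (\<gamma> \<union> inside \<gamma>) \<and> (\<exists>c lam. angle_param P \<gamma> c lam)}"

definition enclosed_area :: "(real^2) set \<Rightarrow> real" where
  "enclosed_area \<gamma> = measure lebesgue (inside \<gamma>)"

definition Q_length :: "(real \<Rightarrow> real) \<Rightarrow> real" where
  "Q_length lam = integral {0..2*pi} lam"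

definition mink_curvature :: "(real^2) set \<Rightarrow> (real \<Rightarrow> real) \<Rightarrow> real \<Rightarrow> real" where
  "mink_curvature P lam \<theta> = bracket (ball_curve P \<theta>) (ball_curve' P \<theta>) / lam \<theta>"

text \<open>The integral of the squared curvature from \<open>0\<close> to the \<open>Q\<close>-length, taken with respect to
  \<open>ds = \<lambda> d\<theta>\<close>.\<close>

definition curvature_energy :: "(real^2) set \<Rightarrow> (real \<Rightarrow> real) \<Rightarrow> real" where
  "curvature_energy P lam = integral {0..2*pi} (\<lambda>\<theta>. (mink_curvature P lam \<theta>)\<^sup>2 * lam \<theta>)"

text \<open>As for \<^term>\<open>infdist\<close>, the value \<open>0\<close> is chosen where the distance is undefined.\<close>

definition hausdorff_dist :: "'a::metric_space set \<Rightarrow> 'a set \<Rightarrow> real" where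
  "hausdorff_dist S T =
     (if bounded S \<and> bounded T \<and> S \<noteq> {} \<and> T \<noteq> {}
      then max (SUP x\<in>S. infdist x T) (SUP y\<in>T. infdist y S) else 0)"

lemma bdd_above_infdist:
  assumes "bounded S"
  shows "bdd_above ((\<lambda>x. infdist x T) ` S)"
proof (cases "T = {}")
  case False
  then obtain t where t: "t \<in> T" by blast
  obtain e where e: "\<And>x. x \<in> S \<Longrightarrow> dist t x \<le> e"
    using assms bounded_any_center[of S t] by blast
  show ?thesis
    using infdist_le2[OF t] e by (intro bdd_aboveI[of _ e]) (auto simp: dist_commute)
qed (auto simp: infdist_def)

lemma hausdorff_dist_le_iff:
  assumes "bounded S" "bounded T" "S \<noteq> {}" "T \<noteq> {}"
  shows "hausdorff_dist S T \<le> d \<longleftrightarrow> (\<forall>x\<in>S. infdist x T \<le> d) \<and> (\<forall>y\<in>T. infdist y S \<le> d)"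
  using assms
  by (simp add: hausdorff_dist_def cSUP_le_iff bdd_above_infdist)

lemma Metric_space_hausdorff_dist:
  fixes M :: "'a::heine_borel set set"
  assumes "\<And>S. S \<in> M \<Longrightarrow> compact S \<and> S \<noteq> {}"
  shows "Metric_space M hausdorff_dist"
proof
  have M: "bounded S" "S \<noteq> {}" "closed S" if "S \<in> M" for S
    using assms[OF that] compact_imp_bounded compact_imp_closed by auto
  have bd: "infdist x T \<le> hausdorff_dist S T" "infdist y S \<le> hausdorff_dist S T"
    if "S \<in> M" "T \<in> M" "x \<in> S" "y \<in> T" for S T x y
    using hausdorff_dist_le_iff[of S T "hausdorff_dist S T"] M that by auto
  show nn: "0 \<le> hausdorff_dist S T" for S T :: "'a set"
    unfolding hausdorff_dist_def
    by (auto intro!: max.coboundedI1 cSUP_upper2 bdd_above_infdist infdist_nonneg)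
  show comm: "hausdorff_dist S T = hausdorff_dist T S" for S T :: "'a set"
    by (auto simp: hausdorff_dist_def max.commute)
  have sub: "S \<subseteq> T" if "S \<in> M" "T \<in> M" "hausdorff_dist S T = 0" for S T
  proof
    fix x assume "x \<in> S"
    then have "infdist x T = 0"
      using bd(1)[OF that(1,2)] M(2)[OF that(2)] that(3) infdist_nonneg[of x T] by fastforce
    then show "x \<in> T" using M[OF that(2)] in_closed_iff_infdist_zero by blast
  qed
  show "hausdorff_dist S T = 0 \<longleftrightarrow> S = T" if "S \<in> M" "T \<in> M" for S T
  proof
    assume "hausdorff_dist S T = 0"
    then show "S = T" using sub that comm by (metis subset_antisym)
  next
    assume "S = T"
    then have "hausdorff_dist S T \<le> 0"
      using hausdorff_dist_le_iff[of S T 0] M that by simp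
    then show "hausdorff_dist S T = 0" using nn[of S T] by simp
  qed
  have tri: "infdist x U \<le> hausdorff_dist S T + hausdorff_dist T U"
    if mem: "S \<in> M" "T \<in> M" "U \<in> M" "x \<in> S" for S T U x
  proof -
    obtain y where y: "y \<in> T" "infdist x T = dist x y"
      using infdist_attains_inf[of T x] M[OF mem(2)] by blast
    obtain u where u: "u \<in> U" using M(2)[OF mem(3)] by blast
    have "infdist x U \<le> infdist y U + dist x y" by (rule infdist_triangle)
    moreover have "infdist x T \<le> hausdorff_dist S T" using bd(1)[of S T x y] mem y by simp
    moreover have "infdist y U \<le> hausdorff_dist T U" using bd(1)[of T U y u] mem y u by simp
    ultimately show ?thesis using y by simp
  qed
  show "hausdorff_dist S U \<le> hausdorff_dist S T + hausdorff_dist T U"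
    if "S \<in> M" "T \<in> M" "U \<in> M" for S T U
    using hausdorff_dist_le_iff[of S U] M that tri[of S T U] tri[of U T S]
    by (simp add: comm add.commute)
qed

lemma Metric_space_curve_space: "Metric_space (curve_space P) hausdorff_dist"
proof (rule Metric_space_hausdorff_dist)
  fix \<gamma> assume "\<gamma> \<in> curve_space P"
  then obtain c lam where c: "angle_param P \<gamma> c lam" by (auto simp: curve_space_def)
  then have "continuous_on {0..2*pi} c"
    unfolding angle_param_def
    by (meson continuous_at_imp_continuous_on has_vector_derivative_continuous)
  then show "compact \<gamma> \<and> \<gamma> \<noteq> {}"
    using c compact_continuous_image[of "{0..2*pi}" c] by (auto simp: angle_param_def)
qed

end

theory Submission
  imports Defs
begin

text \<open>
  Let \<open>a\<close> and \<open>h\<close> be the support functions of the unit ball \<open>P\<close> and of the curve, and let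
  \<open>\<sigma> = a + a''\<close> and \<open>\<rho> = h + h''\<close> be their radii of curvature. Then \<open>\<lambda> = a\<rho>\<close> and \<open>k = \<sigma>/\<rho>\<close>, so that the
  four quantities in the inequality are integrals over a full turn:
  \<open>L = \<integral> a\<rho> = \<integral> h\<sigma>\<close>, \<open>2A = \<integral> h\<rho>\<close>, \<open>2A(P) = \<integral> a\<sigma>\<close>, and the energy is \<open>E = \<integral> a\<sigma>\<^sup>2/\<rho>\<close>.

  For a point \<open>x\<close> put \<open>h\<^sub>x = h - x \<bullet> e\<^sub>r\<close> and \<open>m(x) = \<integral> h\<^sub>x\<^sup>2 \<rho>/a\<close>. Because \<open>L = \<integral> h\<^sub>x \<sigma>\<close> for every \<open>x\<close>, the
  Cauchy-Schwarz inequality gives \<open>L\<^sup>2 \<le> m(x) E\<close> (\<open>len_sq_le\<close>). With \<open>m = min m(x)\<close> and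
  \<open>F = 1 - A(P) m / (L A)\<close> this is exactly the claimed inequality. The minimum \<open>m\<close> of a quadratic
  polynomial in \<open>x\<close> has a closed form (\<open>least_moment\<close>), and \<open>F\<close> is invariant under scaling.

  That \<open>F \<ge> 0\<close> is an inequality of Gage: some \<open>x\<close> satisfies \<open>A(P) m(x) \<le> L A\<close> (\<open>gage_inequality\<close>). By the
  intermediate value theorem there is a chord that joins two points with parallel tangents and bisects
  the area; \<open>x\<close> is its midpoint. Over each of the two half turns \<open>h\<^sub>x\<close> then takes the same value at both
  ends, as does \<open>a\<close>. For a fixed angle \<open>t\<close> of the half turn, \<open>a(t) h\<^sub>x - h\<^sub>x(t) a\<close> vanishes at \<open>t\<close>, and
  Wirtinger's inequality (\<open>wirtinger_antiperiod\<close>) turns into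
  \<open>A a(t)\<^sup>2 - 2 L' h\<^sub>x(t) a(t) + A(P) h\<^sub>x(t)\<^sup>2 \<le> 0\<close>, where \<open>L'\<close> is the length of this half; it is a Bonnesen
  inequality (\<open>half_turn_bonnesen\<close>). Integrating it against \<open>\<rho>/a\<close> and adding the two halves gives
  Gage's inequality. If equality holds, \<open>h\<^sub>x/a\<close> is on each half a root of a fixed quadratic polynomial,
  hence constant, and the curve is \<open>x + r \<partial>P\<close>. Conversely a \<open>P\<close>-circle satisfies \<open>E A = A(P) L\<close>, so the
  inequality itself forces \<open>F = 0\<close>.

  Integration by parts removes the second derivatives: \<open>F\<close> can be written through the form
  \<open>\<integral> (f g - f' g')\<close> (\<open>mixed_form\<close>), which involves only \<open>h\<close> and \<open>h'\<close>. Under Hausdorff convergence both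
  converge pointwise and boundedly, because the point of a curve with outer normal \<open>e\<^sub>r \<theta>\<close> is the
  unique maximizer of \<open>y \<mapsto> y \<bullet> e\<^sub>r \<theta>\<close> on the curve (\<open>C1_converges_support\<close>). Dominated convergence then
  shows that \<open>F\<close> is continuous.
\<close>

section \<open>The rotating frame and periodic functions\<close>

lemma inner_real2: "u \<bullet> v = u $ 1 * v $ 1 + u $ 2 * v $ 2" for u v :: "real^2"
  by (simp add: inner_vec_def sum_2)

lemma frame_nth [simp]:
  "e_r \<theta> $ 1 = cos \<theta>" "e_r \<theta> $ 2 = sin \<theta>" "e_th \<theta> $ 1 = - sin \<theta>" "e_th \<theta> $ 2 = cos \<theta>"
  by (simp_all add: e_r_def e_th_def)

lemma frame_orthonormal [simp]:
  "e_r \<theta> \<bullet> e_r \<theta> = 1" "e_th \<theta> \<bullet> e_th \<theta> = 1" "e_r \<theta> \<bullet> e_th \<theta> = 0" "e_th \<theta> \<bullet> e_r \<theta> = 0"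
  by (simp_all add: inner_real2 flip: power2_eq_square)

lemma norm_e_r [simp]: "norm (e_r \<theta>) = 1"
  by (simp add: norm_eq_sqrt_inner)

lemma frame_expansion: "v = (v \<bullet> e_r \<theta>) *\<^sub>R e_r \<theta> + (v \<bullet> e_th \<theta>) *\<^sub>R e_th \<theta>"
proof -
  have *: "v $ i = v $ i * (cos \<theta>)\<^sup>2 + v $ i * (sin \<theta>)\<^sup>2" for i
    by (simp flip: distrib_left)
  show ?thesis
    using *[of 1] *[of 2]
    by (simp add: vec_eq_iff forall_2 inner_real2 algebra_simps power2_eq_square)
qed

lemma frame_shift [simp]:
  "e_r (\<theta> + 2*pi) = e_r \<theta>" "e_th (\<theta> + 2*pi) = e_th \<theta>" "e_r (\<theta> + pi) = - e_r \<theta>" "e_th (\<theta> + pi) = - e_th \<theta>"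
  by (simp_all add: vec_eq_iff forall_2)

lemma has_vector_derivative_vec2:
  fixes f :: "real \<Rightarrow> real^2"
  assumes "((\<lambda>t. f t $ 1) has_real_derivative v $ 1) (at t)"
    and "((\<lambda>t. f t $ 2) has_real_derivative v $ 2) (at t)"
  shows "(f has_vector_derivative v) (at t)"
proof -
  have "f = (\<lambda>t. f t $ 1 *\<^sub>R axis 1 1 + f t $ 2 *\<^sub>R axis 2 1)"
    by (auto simp: fun_eq_iff vec_eq_iff forall_2 axis_def)
  moreover have "((\<lambda>t. f t $ 1 *\<^sub>R axis 1 1 + f t $ 2 *\<^sub>R axis 2 1) has_vector_derivative v) (at t)"
    using assms by (auto intro!: derivative_eq_intros simp: vec_eq_iff forall_2 axis_def)
  ultimately show ?thesis by simp
qed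

lemma e_r_deriv: "(e_r has_vector_derivative e_th \<theta>) (at \<theta>)"
  by (rule has_vector_derivative_vec2) (auto intro!: derivative_eq_intros)

lemma e_th_deriv: "(e_th has_vector_derivative - e_r \<theta>) (at \<theta>)"
  by (rule has_vector_derivative_vec2) (auto intro!: derivative_eq_intros)

lemma e_r_continuous: "continuous_on S e_r"
  by (rule continuous_at_imp_continuous_on) (use e_r_deriv has_vector_derivative_continuous in blast)

lemma e_th_continuous: "continuous_on S e_th"
  by (rule continuous_at_imp_continuous_on) (use e_th_deriv has_vector_derivative_continuous in blast)

lemma has_real_derivative_inner:
  fixes f g :: "real \<Rightarrow> 'a::real_inner"
  assumes "(f has_vector_derivative f') (at t)" "(g has_vector_derivative g') (at t)"
  shows "((\<lambda>t. f t \<bullet> g t) has_real_derivative f t \<bullet> g' + f' \<bullet> g t) (at t)"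
  using bounded_bilinear.has_vector_derivative[OF bounded_bilinear_inner assms]
  by (simp add: has_real_derivative_iff_has_vector_derivative)

lemma ex_e_r:
  fixes v :: "real^2"
  obtains \<theta> where "v = norm v *\<^sub>R e_r \<theta>"
proof (cases "v = 0")
  case False
  have n: "(norm v)\<^sup>2 = (v $ 1)\<^sup>2 + (v $ 2)\<^sup>2"
    unfolding power2_norm_eq_inner by (simp add: inner_real2 power2_eq_square)
  have "norm v \<noteq> 0" using False by simp
  then have "(v $ 1 / norm v)\<^sup>2 + (v $ 2 / norm v)\<^sup>2 = 1"
    unfolding power_divide add_divide_distrib[symmetric] n[symmetric] by simp
  then obtain \<theta> where "v $ 1 / norm v = cos \<theta>" "v $ 2 / norm v = sin \<theta>"
    using sincos_total_2pi by metis
  then have "v $ 1 = norm v * cos \<theta>" "v $ 2 = norm v * sin \<theta>"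
    using \<open>norm v \<noteq> 0\<close> by (auto simp: divide_eq_eq mult.commute)
  then have "v = norm v *\<^sub>R e_r \<theta>"
    by (simp add: vec_eq_iff forall_2)
  then show ?thesis by (rule that)
qed (auto intro: that)

lemma has_integral_deriv:
  fixes F :: "real \<Rightarrow> real"
  assumes "a \<le> b" "\<And>t. (F has_real_derivative f t) (at t)"
  shows "(f has_integral F b - F a) {a..b}"
  using assms
  by (intro fundamental_theorem_of_calculus)
    (auto simp: has_real_derivative_iff_has_vector_derivative intro: has_vector_derivative_at_within)

lemma continuous_on_deriv:
  fixes f :: "real \<Rightarrow> real"
  assumes "\<And>t. (f has_real_derivative f' t) (at t)"
  shows "continuous_on S f"
  by (rule continuous_at_imp_continuous_on) (use assms DERIV_isCont in blast)

lemma shift_into_period: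
  fixes \<phi> \<theta> :: real
  obtains k :: int where "\<theta> \<le> \<phi> + 2*pi * k" "\<phi> + 2*pi * k < \<theta> + 2*pi"
proof
  define k where "k = - \<lfloor>(\<phi> - \<theta>) / (2*pi)\<rfloor>"
  show "\<theta> \<le> \<phi> + 2*pi * of_int k" "\<phi> + 2*pi * of_int k < \<theta> + 2*pi"
    using floor_divide_lower[of "2*pi" "\<phi> - \<theta>"] floor_divide_upper[of "2*pi" "\<phi> - \<theta>"]
    by (simp_all add: k_def algebra_simps)
qed

lemma periodic_int:
  fixes f :: "real \<Rightarrow> 'a"
  assumes "\<And>\<theta>. f (\<theta> + 2*pi) = f \<theta>"
  shows "f (\<theta> + 2*pi * of_int k) = f \<theta>"
proof -
  have nat: "f (\<theta> + 2*pi * of_nat n) = f \<theta>" for n \<theta>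
  proof (induction n)
    case (Suc n)
    have "f (\<theta> + 2*pi * of_nat (Suc n)) = f ((\<theta> + 2*pi * of_nat n) + 2*pi)"
      by (simp add: algebra_simps)
    then show ?case using Suc assms by metis
  qed simp
  show ?thesis
  proof (cases k)
    case (nonneg n)
    then show ?thesis using nat[of \<theta> n] by simp
  next
    case (neg n)
    then have k: "real_of_int k = - 1 - real n" by simp
    have eq: "\<theta> + 2*pi * of_int k + 2*pi * of_nat (Suc n) = \<theta>"
      unfolding k by (simp add: algebra_simps)
    show ?thesis using nat[of "\<theta> + 2*pi * of_int k" "Suc n"] unfolding eq by simp
  qed
qed

lemma range_periodic:
  fixes f :: "real \<Rightarrow> 'a"
  assumes "\<And>\<theta>. f (\<theta> + 2*pi) = f \<theta>"
  shows "f ` {0..2*pi} = range f"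
proof -
  have "f \<theta> \<in> f ` {0..2*pi}" for \<theta>
  proof -
    obtain k :: int where "0 \<le> \<theta> + 2*pi * k" "\<theta> + 2*pi * k < 0 + 2*pi"
      by (rule shift_into_period)
    then have "f (\<theta> + 2*pi * of_int k) \<in> f ` {0..2*pi}" by auto
    then show ?thesis by (simp only: periodic_int[of f, OF assms])
  qed
  then show ?thesis by auto
qed

section \<open>Ovals and their support functions\<close>

text \<open>An oval is parametrized by the angle of its outer normal, with radius of curvature \<open>\<rho> > 0\<close>. Both the
  boundary of the unit ball and every admissible curve are of this form. The sign of \<open>\<rho>\<close> is what makes
  the curve convex.\<close>
locale oval =
  fixes c :: "real \<Rightarrow> real^2" and \<rho> :: "real \<Rightarrow> real"
  assumes periodic: "c (\<theta> + 2*pi) = c \<theta>"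
    and tangent: "(c has_vector_derivative \<rho> \<theta> *\<^sub>R e_th \<theta>) (at \<theta>)"
    and pos: "\<rho> \<theta> > 0"
    and cont: "continuous_on UNIV \<rho>"
begin

text \<open>The support function \<open>h\<close> and its derivative \<open>h1\<close>, the coordinates of \<open>c\<close> in the rotating frame.\<close>
definition "h \<theta> = c \<theta> \<bullet> e_r \<theta>"
definition "h1 \<theta> = c \<theta> \<bullet> e_th \<theta>"

lemma c_frame: "c \<theta> = h \<theta> *\<^sub>R e_r \<theta> + h1 \<theta> *\<^sub>R e_th \<theta>"
  unfolding h_def h1_def by (rule frame_expansion)

lemma h_deriv: "(h has_real_derivative h1 \<theta>) (at \<theta>)"
  using has_real_derivative_inner[OF tangent e_r_deriv]
  by (simp add: h_def[abs_def] h1_def)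

lemma h1_deriv: "(h1 has_real_derivative \<rho> \<theta> - h \<theta>) (at \<theta>)"
  using has_real_derivative_inner[OF tangent e_th_deriv]
  by (simp add: h_def h1_def[abs_def])

lemma h_periodic: "h (\<theta> + 2*pi) = h \<theta>" and h1_periodic: "h1 (\<theta> + 2*pi) = h1 \<theta>"
  by (simp_all add: h_def h1_def periodic)

lemma \<rho>_periodic: "\<rho> (\<theta> + 2*pi) = \<rho> \<theta>"
proof -
  have "((\<lambda>t. h1 (t + 2*pi)) has_real_derivative \<rho> (\<theta> + 2*pi) - h (\<theta> + 2*pi)) (at \<theta>)"
    by (subst DERIV_shift[symmetric]) (rule h1_deriv)
  moreover have "(\<lambda>t. h1 (t + 2*pi)) = h1" by (simp add: h1_periodic)
  ultimately have "\<rho> (\<theta> + 2*pi) - h (\<theta> + 2*pi) = \<rho> \<theta> - h \<theta>"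
    using h1_deriv DERIV_unique by metis
  then show ?thesis by (simp add: h_periodic)
qed

lemma c_continuous: "continuous_on S c"
  by (rule continuous_at_imp_continuous_on) (use tangent has_vector_derivative_continuous in blast)

lemma h_continuous: "continuous_on S h" and h1_continuous: "continuous_on S h1"
  by (rule continuous_on_deriv, rule h_deriv, rule continuous_on_deriv, rule h1_deriv)

lemma \<rho>_continuous: "continuous_on S \<rho>"
  using cont continuous_on_subset by blast

lemma range_c: "c ` {0..2*pi} = range c"
  by (rule range_periodic) (rule periodic)

text \<open>The height \<open>t \<mapsto> c t \<bullet> e_r \<theta>\<close> has derivative \<open>- \<rho> t sin (t - \<theta>)\<close>: it falls during the half turn after
  \<open>\<theta>\<close> and rises back during the next one. So \<open>c \<theta>\<close> is the only highest point in the direction \<open>e_r \<theta>\<close>.\<close>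
lemma height_strict:
  assumes "\<theta> < \<phi>" "\<phi> < \<theta> + 2*pi"
  shows "c \<phi> \<bullet> e_r \<theta> < h \<theta>"
proof -
  define g where "g t = c t \<bullet> e_r \<theta>" for t
  have sd: "e_th t \<bullet> e_r \<theta> = - sin (t - \<theta>)" for t
    by (simp add: inner_real2 sin_diff)
  have d: "(g has_real_derivative - \<rho> t * sin (t - \<theta>)) (at t)" for t
    using has_real_derivative_inner[OF tangent has_vector_derivative_const, of "e_r \<theta>" t]
    by (simp add: g_def[abs_def] sd)
  show ?thesis
  proof (cases "\<phi> \<le> \<theta> + pi")
    case True
    have "g \<phi> < g \<theta>"
    proof (rule DERIV_neg_imp_decreasing_open[of \<theta> \<phi> g])
      fix x assume "\<theta> < x" "x < \<phi>"
      then have "sin (x - \<theta>) > 0" using True by (intro sin_gt_zero) auto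
      then show "\<exists>y. DERIV g x :> y \<and> y < 0" using d[of x] pos[of x] by (auto simp: mult_pos_pos)
    qed (use assms continuous_on_deriv[OF d] in auto)
    then show ?thesis by (simp add: g_def h_def)
  next
    case False
    have "g \<phi> < g (\<theta> + 2*pi)"
    proof (rule DERIV_pos_imp_increasing_open[of \<phi> "\<theta> + 2*pi" g])
      fix x assume "\<phi> < x" "x < \<theta> + 2*pi"
      then have "sin (x - \<theta>) < 0" using False by (intro sin_lt_zero) auto
      then show "\<exists>y. DERIV g x :> y \<and> 0 < y" using d[of x] pos[of x] by (auto simp: mult_pos_neg)
    qed (use assms continuous_on_deriv[OF d] in auto)
    then show ?thesis by (simp add: g_def h_def periodic)
  qed
qed

lemma height_max: "c \<phi> \<bullet> e_r \<theta> \<le> h \<theta>" (is ?le)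
  and height_max_eq: "c \<phi> \<bullet> e_r \<theta> = h \<theta> \<Longrightarrow> c \<phi> = c \<theta>"
proof -
  obtain k where k: "\<theta> \<le> \<phi> + 2*pi * of_int k" "\<phi> + 2*pi * of_int k < \<theta> + 2*pi"
    by (rule shift_into_period)
  have c: "c (\<phi> + 2*pi * of_int k) = c \<phi>" by (rule periodic_int) (rule periodic)
  consider "\<theta> = \<phi> + 2*pi * of_int k" | "\<theta> < \<phi> + 2*pi * of_int k" using k by linarith
  then have "c \<phi> = c \<theta> \<or> c \<phi> \<bullet> e_r \<theta> < h \<theta>"
    using height_strict[of \<theta> "\<phi> + 2*pi * of_int k"] k c by cases auto
  then show ?le "c \<phi> \<bullet> e_r \<theta> = h \<theta> \<Longrightarrow> c \<phi> = c \<theta>"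
    by (auto simp: h_def)
qed

lemma injective: "inj_on c {0..<2*pi}"
proof (rule linorder_inj_onI')
  fix x y :: real assume "x \<in> {0..<2*pi}" "y \<in> {0..<2*pi}" "x < y"
  then show "c x \<noteq> c y" using height_strict[of x y] by (auto simp: h_def)
qed

lemma support_fun_range: "support_fun (range c) = h"
proof
  fix \<theta>
  show "support_fun (range c) \<theta> = h \<theta>"
    unfolding support_fun_def
    by (rule cSup_eq_maximum) (use height_max in \<open>auto simp: h_def\<close>)
qed

lemma bounded_range: "bounded (range c)"
  using compact_continuous_image[OF c_continuous, of "{0..2*pi}"] range_c compact_imp_bounded
  by auto

definition "region = {x. \<forall>\<theta>. x \<bullet> e_r \<theta> < h \<theta>}"
definition "closed_region = {x. \<forall>\<theta>. x \<bullet> e_r \<theta> \<le> h \<theta>}"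

text \<open>No \<open>e_r \<theta>\<close> is maximized at both \<open>c 0\<close> and \<open>c pi\<close>, so their midpoint stays strictly below every
  supporting line.\<close>
lemma region_nonempty: "(1/2) *\<^sub>R (c 0 + c pi) \<in> region"
proof -
  have "c 0 \<noteq> c pi" using height_strict[of 0 pi] by (auto simp: h_def)
  then have "c 0 \<bullet> e_r \<theta> + c pi \<bullet> e_r \<theta> < h \<theta> * 2" for \<theta>
    using height_max[of 0 \<theta>] height_max[of pi \<theta>] height_max_eq[of 0 \<theta>] height_max_eq[of pi \<theta>]
    by fastforce
  then show ?thesis by (simp add: region_def inner_add_left)
qed

lemma interior_closed_region: "interior closed_region = region"
proof
  show "interior closed_region \<subseteq> region"
  proof
    fix x assume "x \<in> interior closed_region"
    then obtain e where e: "e > 0" "cball x e \<subseteq> closed_region" by (auto simp: mem_interior_cball)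
    have "x \<bullet> e_r \<theta> < h \<theta>" for \<theta>
    proof -
      \<comment> \<open>An interior point can be pushed outwards by \<open>e\<close> and still lies below the line.\<close>
      have "x + e *\<^sub>R e_r \<theta> \<in> closed_region" using e by (auto simp: dist_norm)
      then show ?thesis
        using e(1) by (auto simp: closed_region_def inner_add_left dest!: spec[of _ \<theta>])
    qed
    then show "x \<in> region" by (simp add: region_def)
  qed
  show "region \<subseteq> interior closed_region"
  proof
    fix x assume x: "x \<in> region"
    obtain t where t: "\<And>s. s \<in> {0..2*pi} \<Longrightarrow> h t - x \<bullet> e_r t \<le> h s - x \<bullet> e_r s"
    proof -
      have "continuous_on {0..2*pi} (\<lambda>s. h s - x \<bullet> e_r s)"
        by (intro continuous_intros h_continuous e_r_continuous)
      then show thesis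
        using continuous_attains_inf[of "{0..2*pi}" "\<lambda>s. h s - x \<bullet> e_r s"] that
        by (metis atLeastAtMost_iff compact_Icc empty_iff order_refl pi_ge_zero mult_nonneg_nonneg zero_le_numeral)
    qed
    have all: "h t - x \<bullet> e_r t \<le> h s - x \<bullet> e_r s" for s
    proof -
      have "(\<lambda>s. h s - x \<bullet> e_r s) s \<in> range (\<lambda>s. h s - x \<bullet> e_r s)" by blast
      also have "\<dots> = (\<lambda>s. h s - x \<bullet> e_r s) ` {0..2*pi}"
        by (rule range_periodic[symmetric]) (simp add: h_periodic)
      finally show ?thesis using t by auto
    qed
    have "ball x (h t - x \<bullet> e_r t) \<subseteq> closed_region"
    proof
      fix y assume "y \<in> ball x (h t - x \<bullet> e_r t)"
      then have y: "norm (y - x) < h t - x \<bullet> e_r t" by (simp add: dist_norm norm_minus_commute)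
      have "y \<bullet> e_r s \<le> h s" for s
        using norm_cauchy_schwarz[of "y - x" "e_r s"] y all[of s] by (simp add: inner_diff_left)
      then show "y \<in> closed_region" by (simp add: closed_region_def)
    qed
    moreover have "h t - x \<bullet> e_r t > 0" using x by (simp add: region_def)
    ultimately show "x \<in> interior closed_region" unfolding mem_interior by blast
  qed
qed

lemma closed_region_closed: "closed closed_region" and closed_region_convex: "convex closed_region"
proof -
  have *: "closed_region = (\<Inter>\<theta>. {x. e_r \<theta> \<bullet> x \<le> h \<theta>})"
    by (auto simp: closed_region_def inner_commute)
  show "closed closed_region" unfolding * by (intro closed_INT ballI closed_halfspace_le)
  show "convex closed_region" unfolding * by (intro convex_INT convex_halfspace_le)
qed

lemma closed_region_bounded: "bounded closed_region"
proof -
  obtain B where B: "\<And>\<theta>. norm (c \<theta>) \<le> B" using bounded_range by (auto simp: bounded_iff)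
  have "norm x \<le> B" if "x \<in> closed_region" for x
  proof -
    obtain \<theta> where \<theta>: "x = norm x *\<^sub>R e_r \<theta>" by (rule ex_e_r)
    have "norm x = x \<bullet> e_r \<theta>" by (subst (2) \<theta>) simp
    also have "\<dots> \<le> c \<theta> \<bullet> e_r \<theta>" using that by (simp add: closed_region_def h_def)
    also have "\<dots> \<le> B" using norm_cauchy_schwarz[of "c \<theta>" "e_r \<theta>"] B[of \<theta>] by simp
    finally show ?thesis .
  qed
  then show ?thesis by (auto simp: bounded_iff)
qed

text \<open>A point of the closed region on the supporting line with normal \<open>e_r \<theta>\<close> minimizes
  \<open>t \<mapsto> h t - x \<bullet> e_r t\<close> at \<open>\<theta>\<close>. The vanishing derivative fixes its second frame coordinate as well.\<close>
lemma touching_point: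
  assumes "x \<in> closed_region" "x \<bullet> e_r \<theta> = h \<theta>"
  shows "x = c \<theta>"
proof -
  define g where "g t = h t - x \<bullet> e_r t" for t
  have d: "(g has_real_derivative h1 \<theta> - x \<bullet> e_th \<theta>) (at \<theta>)"
    unfolding g_def using has_real_derivative_inner[OF has_vector_derivative_const e_r_deriv, of x \<theta>]
    by (auto intro!: derivative_eq_intros h_deriv)
  have "h1 \<theta> - x \<bullet> e_th \<theta> = 0"
    by (rule DERIV_local_min[OF d, of 1]) (use assms in \<open>auto simp: g_def closed_region_def\<close>)
  then show ?thesis
    using frame_expansion[of x \<theta>] c_frame[of \<theta>] assms(2) by simp
qed

lemma frontier_closed_region: "frontier closed_region = range c"
proof -
  have "frontier closed_region = closed_region - region"
    by (simp add: frontier_def closed_region_closed interior_closed_region)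
  also have "\<dots> = range c"
  proof
    show "range c \<subseteq> closed_region - region"
      using height_max by (auto simp: closed_region_def region_def h_def)
    show "closed_region - region \<subseteq> range c"
    proof
      fix x assume x: "x \<in> closed_region - region"
      then obtain \<theta> where "x \<bullet> e_r \<theta> = h \<theta>"
        by (auto simp: closed_region_def region_def not_less intro: antisym)
      then show "x \<in> range c" using touching_point x by blast
    qed
  qed
  finally show ?thesis .
qed

text \<open>The curve is the frontier of a bounded convex set, and the inside of such a frontier is the interior
  of the set.\<close>
lemma inside_range: "inside (range c) = region"
  using inside_frontier_eq_interior[OF closed_region_bounded closed_region_convex]
  by (simp add: frontier_closed_region interior_closed_region)

end

section \<open>The area enclosed by an oval\<close>

lemma has_derivative_of_coordinate:
  fixes \<phi> :: "real \<Rightarrow> 'a::real_normed_vector" and y :: "real^'n"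
  assumes "(\<phi> has_vector_derivative d) (at (y $ i))"
  shows "((\<lambda>y. \<phi> (y $ i)) has_derivative (\<lambda>v. v $ i *\<^sub>R d)) (at y within S)"
proof -
  have "((\<lambda>y::real^'n. y $ i) has_derivative (\<lambda>v. v $ i)) (at y within S)"
    by (rule bounded_linear_imp_has_derivative) (rule bounded_linear_vec_nth)
  from has_derivative_compose[OF this assms[unfolded has_vector_derivative_def]]
  show ?thesis .
qed

lemma measure_box_real2:
  fixes a b :: "real^2"
  assumes "a $ 1 \<le> b $ 1" "a $ 2 \<le> b $ 2"
  shows "measure lebesgue (box a b) = (b $ 1 - a $ 1) * (b $ 2 - a $ 2)"
proof -
  have ne: "cbox a b \<noteq> {}"
    using assms by (simp add: interval_ne_empty_cart forall_2)
  have "measure lebesgue (box a b) = measure lborel (cbox a b)"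
    by (simp add: measure_lborel_box_eq measure_lborel_cbox_eq)
  also have "\<dots> = (b $ 1 - a $ 1) * (b $ 2 - a $ 2)"
    using content_cbox_cart[OF ne] by (simp add: UNIV_2)
  finally show ?thesis .
qed

context oval
begin

text \<open>Generalized polar coordinates: the angle picks a boundary point and the first coordinate \<open>s\<close> the
  dilation \<open>sqrt (2s)\<close>. The square root makes the Jacobian \<open>h \<rho>\<close>, a function of the angle alone.\<close>
definition polar :: "real^2 \<Rightarrow> real^2" where
  "polar y = sqrt (2 * y $ 1) *\<^sub>R c (y $ 2)"

definition polar' :: "real^2 \<Rightarrow> real^2 \<Rightarrow> real^2" where
  "polar' y v = sqrt (2 * y $ 1) *\<^sub>R v $ 2 *\<^sub>R \<rho> (y $ 2) *\<^sub>R e_th (y $ 2)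
     + (v $ 1 *\<^sub>R (1 / sqrt (2 * y $ 1))) *\<^sub>R c (y $ 2)"

definition "polar_domain = box (0 :: real^2) (vector [1/2, 2*pi])"

lemma mem_polar_domain:
  "y \<in> polar_domain \<longleftrightarrow> 0 < y $ 1 \<and> y $ 1 < 1/2 \<and> 0 < y $ 2 \<and> y $ 2 < 2*pi"
  by (auto simp: polar_domain_def mem_box_cart forall_2)

lemma polar_has_derivative:
  assumes "y \<in> polar_domain"
  shows "(polar has_derivative polar' y) (at y within S)"
proof -
  have "((\<lambda>s. sqrt (2 * s)) has_vector_derivative 1 / sqrt (2 * y $ 1)) (at (y $ 1))"
    using assms unfolding has_real_derivative_iff_has_vector_derivative[symmetric]
    by (auto simp: mem_polar_domain intro!: derivative_eq_intros) (simp add: field_simps)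
  from has_derivative_scaleR[OF has_derivative_of_coordinate[OF this]
      has_derivative_of_coordinate[OF tangent[of "y $ 2"]]]
  show ?thesis
    unfolding polar_def[abs_def] polar'_def[abs_def] .
qed

lemma det_polar':
  assumes "y \<in> polar_domain"
  shows "det (matrix (polar' y)) = h (y $ 2) * \<rho> (y $ 2)"
proof -
  have s: "sqrt (2 * y $ 1) > 0" using assms by (simp add: mem_polar_domain)
  have "h (y $ 2) = c (y $ 2) $ 1 * cos (y $ 2) + c (y $ 2) $ 2 * sin (y $ 2)"
    by (simp add: h_def inner_real2)
  then show ?thesis
    using s by (simp add: det_2 matrix_def polar'_def axis_def field_simps)
qed

text \<open>Two representations of the same point have the same dilation factor, since the factor is the
  largest value of \<open>x \<bullet> e_r \<theta> / h \<theta>\<close>; then the angles agree as \<open>c\<close> is injective on a period.\<close>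
lemma polar_inj:
  assumes "\<And>\<theta>. h \<theta> > 0"
  shows "inj_on polar polar_domain"
proof (rule inj_onI)
  have le: "y $ 1 \<le> z $ 1" if "y \<in> polar_domain" "z \<in> polar_domain" "polar y = polar z" for y z
  proof -
    have "sqrt (2 * y $ 1) * h (y $ 2) = polar y \<bullet> e_r (y $ 2)"
      by (simp add: polar_def h_def)
    also have "\<dots> = polar z \<bullet> e_r (y $ 2)" by (simp only: that(3))
    also have "\<dots> = sqrt (2 * z $ 1) * (c (z $ 2) \<bullet> e_r (y $ 2))" by (simp add: polar_def)
    also have "\<dots> \<le> sqrt (2 * z $ 1) * h (y $ 2)"
      using that by (intro mult_left_mono height_max) (simp add: mem_polar_domain)
    finally show ?thesis using assms[of "y $ 2"] by simp
  qed
  fix y z assume yz: "y \<in> polar_domain" "z \<in> polar_domain" "polar y = polar z"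
  then have 1: "y $ 1 = z $ 1" using le[of y z] le[of z y] by simp
  moreover have "y $ 1 > 0" using yz by (simp add: mem_polar_domain)
  ultimately have "c (y $ 2) = c (z $ 2)" using yz(3) by (simp add: polar_def)
  then have "y $ 2 = z $ 2"
    using yz by (intro inj_onD[OF injective]) (auto simp: mem_polar_domain)
  then show "y = z" using 1 by (simp add: vec_eq_iff forall_2)
qed

text \<open>The open rectangle misses only the dilations of the boundary point \<open>c 0\<close>. A nonzero point \<open>x\<close> of the
  region is reached with the angle that maximizes \<open>x \<bullet> e_r s / h s\<close>, because dividing \<open>x\<close> by this
  maximum gives a point that touches a supporting line.\<close>
lemma polar_image:
  assumes pos: "\<And>\<theta>. h \<theta> > 0"
  shows "polar ` polar_domain \<subseteq> region"
    and "region - polar ` polar_domain \<subseteq> closed_segment 0 (c 0)"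
proof -
  show "polar ` polar_domain \<subseteq> region"
  proof (clarsimp simp: region_def)
    fix y \<theta> assume "y \<in> polar_domain"
    then have s: "0 \<le> sqrt (2 * y $ 1)" "sqrt (2 * y $ 1) < 1" by (auto simp: mem_polar_domain)
    have "polar y \<bullet> e_r \<theta> = sqrt (2 * y $ 1) * (c (y $ 2) \<bullet> e_r \<theta>)" by (simp add: polar_def)
    also have "\<dots> \<le> sqrt (2 * y $ 1) * h \<theta>" using s by (intro mult_left_mono height_max)
    also have "\<dots> < h \<theta>" using s pos[of \<theta>] by simp
    finally show "polar y \<bullet> e_r \<theta> < h \<theta>" .
  qed
  show "region - polar ` polar_domain \<subseteq> closed_segment 0 (c 0)"
  proof
    fix x assume x: "x \<in> region - polar ` polar_domain"
    show "x \<in> closed_segment 0 (c 0)"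
    proof (cases "x = 0")
      case False
      define g where "g s = (x \<bullet> e_r s) / h s" for s
      have "h s \<noteq> 0" for s using pos[of s] by simp
      then have "continuous_on {0..2*pi} g"
        unfolding g_def by (intro continuous_intros h_continuous e_r_continuous) auto
      then obtain t where t: "t \<in> {0..2*pi}" "\<And>s. s \<in> {0..2*pi} \<Longrightarrow> g s \<le> g t"
        using continuous_attains_sup[of "{0..2*pi}" g] by fastforce
      have g_le: "g s \<le> g t" for s
      proof -
        have "g s \<in> range g" by blast
        also have "\<dots> = g ` {0..2*pi}"
          by (rule range_periodic[symmetric]) (simp add: g_def h_periodic)
        finally show ?thesis using t(2) by auto
      qed
      obtain s where s: "x = norm x *\<^sub>R e_r s" by (rule ex_e_r)
      have "x \<bullet> e_r s = norm x" by (subst s) simp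
      then have "g s > 0" using False pos[of s] by (simp add: g_def)
      then have r0: "g t > 0" using g_le[of s] by simp
      have r1: "g t < 1" using x pos[of t] by (simp add: g_def region_def)
      have "(1 / g t) *\<^sub>R x = c t"
      proof (rule touching_point)
        have "x \<bullet> e_r s \<le> g t * h s" for s
          using g_le[of s] pos[of s] by (simp add: g_def[of s] pos_divide_le_eq)
        then show "(1 / g t) *\<^sub>R x \<in> closed_region"
          using r0 by (simp add: closed_region_def pos_divide_le_eq mult.commute)
        show "((1 / g t) *\<^sub>R x) \<bullet> e_r t = h t"
          using r0 pos[of t] by (auto simp: g_def)
      qed
      then have xt: "x = g t *\<^sub>R c t" using r0 by (metis less_numeral_extra(3) nonzero_divide_eq_eq scaleR_one scaleR_scaleR mult.commute)
      show ?thesis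
      proof (cases "t = 0 \<or> t = 2*pi")
        case True
        then have "c t = c 0" using periodic[of 0] by auto
        then show ?thesis using xt r0 r1 by (auto simp: in_segment intro!: exI[of _ "g t"])
      next
        case False
        have "x = polar (vector [(g t)\<^sup>2 / 2, t])" using xt r0 by (simp add: polar_def)
        moreover have "vector [(g t)\<^sup>2 / 2, t] \<in> polar_domain"
          using False t(1) r0 r1 by (auto simp: mem_polar_domain power_less_one_iff)
        ultimately show ?thesis using x by blast
      qed
    qed simp
  qed
qed

text \<open>The vector \<open>w = vector [- x $ 2, x $ 1]\<close> is \<open>x\<close> turned by a right angle, so \<open>x \<bullet> e_r = w \<bullet> e_th\<close> and the
  integrand is the derivative of \<open>c \<bullet> w\<close>.\<close>
lemma has_integral_e_r:
  assumes "s \<le> t"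
  shows "((\<lambda>\<theta>. (x \<bullet> e_r \<theta>) * \<rho> \<theta>) has_integral (c t - c s) \<bullet> vector [- x $ 2, x $ 1]) {s..t}"
proof -
  have "((\<lambda>\<theta>. c \<theta> \<bullet> vector [- x $ 2, x $ 1]) has_real_derivative (x \<bullet> e_r \<theta>) * \<rho> \<theta>) (at \<theta>)" for \<theta>
    using has_real_derivative_inner[OF tangent has_vector_derivative_const, of "vector [- x $ 2, x $ 1]" \<theta>]
    by (simp add: inner_real2 algebra_simps)
  from has_integral_deriv[OF assms this] show ?thesis by (simp add: inner_diff_left)
qed

text \<open>If \<open>U\<close> is an antiderivative of \<open>h \<rho>\<close>, the map \<open>(s, \<theta>) \<mapsto> (s, U \<theta>)\<close> has the same Jacobian as the polar map
  and sends the parameter rectangle onto another rectangle. Hence the region has the area of that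
  rectangle.\<close>
lemma measure_region_star:
  assumes h_pos: "\<And>\<theta>. h \<theta> > 0"
  shows "measure lebesgue region = integral {0..2*pi} (\<lambda>\<theta>. h \<theta> * \<rho> \<theta>) / 2"
proof -
  have cont: "continuous_on {0..2*pi} (\<lambda>\<theta>. h \<theta> * \<rho> \<theta>)"
    by (intro continuous_intros h_continuous \<rho>_continuous)
  obtain U where U: "\<And>\<theta>. \<theta> \<in> {0..2*pi} \<Longrightarrow>
      (U has_vector_derivative h \<theta> * \<rho> \<theta>) (at \<theta> within {0..2*pi})"
    using antiderivative_continuous[OF cont] by blast
  have U_at: "(U has_vector_derivative h \<theta> * \<rho> \<theta>) (at \<theta>)" if "0 < \<theta>" "\<theta> < 2*pi" for \<theta>
    using U[of \<theta>] that by (simp add: at_within_Icc_at)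
  have U_cont: "continuous_on {0..2*pi} U"
    unfolding continuous_on_eq_continuous_within using U has_vector_derivative_continuous by blast
  have U_int: "integral {0..2*pi} (\<lambda>\<theta>. h \<theta> * \<rho> \<theta>) = U (2*pi) - U 0"
    by (intro integral_unique fundamental_theorem_of_calculus U) auto
  have U_mono: "U s < U t" if "0 \<le> s" "s < t" "t \<le> 2*pi" for s t
  proof (rule DERIV_pos_imp_increasing_open[of s t U])
    fix x assume "s < x" "x < t"
    then have "DERIV U x :> h x * \<rho> x"
      using U_at[of x] that by (simp add: has_real_derivative_iff_has_vector_derivative)
    then show "\<exists>y. DERIV U x :> y \<and> y > 0" using h_pos[of x] pos[of x] by auto
  qed (use that continuous_on_subset[OF U_cont] in auto)
  define G :: "real^2 \<Rightarrow> real^2" where "G y = vector [y $ 1, U (y $ 2)]" for y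
  define G' :: "real^2 \<Rightarrow> real^2 \<Rightarrow> real^2" where
    "G' y v = vector [v $ 1, v $ 2 * (h (y $ 2) * \<rho> (y $ 2))]" for y v
  have G_der: "(G has_derivative G' y) (at y within polar_domain)" if "y \<in> polar_domain" for y
  proof -
    have G: "G = (\<lambda>y. y $ 1 *\<^sub>R axis 1 1 + U (y $ 2) *\<^sub>R axis 2 1)"
      and G': "G' y = (\<lambda>v. v $ 1 *\<^sub>R axis 1 1 + (v $ 2 *\<^sub>R (h (y $ 2) * \<rho> (y $ 2))) *\<^sub>R axis 2 1)"
      by (auto simp: G_def G'_def fun_eq_iff vec_eq_iff forall_2 axis_def)
    have "((\<lambda>y. U (y $ 2)) has_derivative (\<lambda>v. v $ 2 *\<^sub>R (h (y $ 2) * \<rho> (y $ 2)))) (at y within polar_domain)"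
      using that by (intro has_derivative_of_coordinate U_at) (auto simp: mem_polar_domain)
    moreover have "((\<lambda>y. y $ 1) has_derivative (\<lambda>v. v $ 1)) (at y within polar_domain)"
      by (rule bounded_linear_imp_has_derivative) (rule bounded_linear_vec_nth)
    ultimately show ?thesis unfolding G G'
      by (intro has_derivative_add has_derivative_scaleR_left)
  qed
  have det_G': "det (matrix (G' y)) = h (y $ 2) * \<rho> (y $ 2)" for y
    by (simp add: det_2 matrix_def G'_def axis_def)
  have G_inj: "inj_on G polar_domain"
  proof (rule inj_onI)
    fix y z assume yz: "y \<in> polar_domain" "z \<in> polar_domain" "G y = G z"
    then have "y $ 1 = z $ 1" "U (y $ 2) = U (z $ 2)"
      by (auto simp: G_def vec_eq_iff forall_2)
    then show "y = z"
      using U_mono[of "y $ 2" "z $ 2"] U_mono[of "z $ 2" "y $ 2"] yz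
      by (cases "y $ 2" "z $ 2" rule: linorder_cases) (auto simp: mem_polar_domain vec_eq_iff forall_2)
  qed
  have G_image: "G ` polar_domain = box (vector [0, U 0]) (vector [1/2, U (2*pi)])"
  proof (intro equalityI subsetI)
    fix z assume "z \<in> G ` polar_domain"
    then show "z \<in> box (vector [0, U 0]) (vector [1/2, U (2*pi)])"
      using U_mono by (auto simp: G_def mem_polar_domain mem_box_cart forall_2)
  next
    fix z :: "real^2" assume "z \<in> box (vector [0, U 0]) (vector [1/2, U (2*pi)])"
    then have z: "0 < z $ 1" "z $ 1 < 1/2" "U 0 < z $ 2" "z $ 2 < U (2*pi)"
      by (auto simp: mem_box_cart forall_2)
    then obtain t where t: "0 \<le> t" "t \<le> 2*pi" "U t = z $ 2"
      using IVT'[of U 0 "z $ 2" "2*pi"] U_cont by auto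
    then have "t \<noteq> 0" "t \<noteq> 2*pi" using z by auto
    then have "vector [z $ 1, t] \<in> polar_domain" "z = G (vector [z $ 1, t])"
      using z t by (auto simp: mem_polar_domain G_def vec_eq_iff forall_2)
    then show "z \<in> G ` polar_domain" by blast
  qed
  have dom: "polar_domain \<in> sets lebesgue" by (simp add: polar_domain_def)
  have int: "(\<lambda>y::real^2. \<bar>h (y $ 2) * \<rho> (y $ 2)\<bar>) integrable_on polar_domain"
    unfolding polar_domain_def integrable_on_open_interval
    by (intro integrable_continuous continuous_intros
        continuous_on_compose2[OF h_continuous[of UNIV]] continuous_on_compose2[OF \<rho>_continuous[of UNIV]]) auto
  have "(\<lambda>y. \<bar>det (matrix (polar' y))\<bar>) integrable_on polar_domain"
    by (rule integrable_eq[OF int]) (simp add: det_polar')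
  note polar = this polar_inj[OF h_pos] dom
  have "polar ` polar_domain \<in> lmeasurable"
    by (subst measurable_differentiable_image_eq[of _ polar polar']) (use polar polar_has_derivative in auto)
  moreover have "negligible (closed_segment 0 (c 0))"
  proof -
    have "c 0 \<noteq> 0" using h_pos[of 0] by (auto simp: h_def)
    then have "vector [- c 0 $ 2, c 0 $ 1] \<noteq> (0 :: real^2)"
      by (auto simp: vec_eq_iff forall_2)
    moreover have "closed_segment 0 (c 0) \<subseteq> {x. vector [- c 0 $ 2, c 0 $ 1] \<bullet> x = 0}"
      by (auto simp: in_segment inner_real2)
    ultimately show ?thesis using negligible_hyperplane negligible_subset by blast
  qed
  then have "negligible (polar ` polar_domain - region \<union> (region - polar ` polar_domain))"
    using polar_image[OF h_pos] by (intro negligible_Un negligible_subset[OF _ polar_image(2)[OF h_pos]]) (auto simp: Diff_eq_empty_iff[THEN iffD2])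
  ultimately have "measure lebesgue region = measure lebesgue (polar ` polar_domain)"
    by (rule measure_negligible_symdiff)
  also have "\<dots> = integral polar_domain (\<lambda>y. \<bar>det (matrix (polar' y))\<bar>)"
    by (rule measure_differentiable_image_eq) (use polar polar_has_derivative in auto)
  also have "\<dots> = integral polar_domain (\<lambda>y. \<bar>det (matrix (G' y))\<bar>)"
    by (rule integral_cong) (simp add: det_polar' det_G')
  also have "\<dots> = measure lebesgue (G ` polar_domain)"
    by (rule measure_differentiable_image_eq[symmetric]) (use dom G_der G_inj int in \<open>auto simp: det_G'\<close>)
  also have "\<dots> = (U (2*pi) - U 0) / 2"
    using U_mono[of 0 "2*pi"] measure_box_real2[of "vector [0, U 0]" "vector [1/2, U (2*pi)]"]
    by (simp add: G_image)
  finally show ?thesis by (simp add: U_int)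
qed

lemma oval_translate: "oval (\<lambda>\<theta>. c \<theta> - x) \<rho>"
proof
  show "((\<lambda>\<theta>. c \<theta> - x) has_vector_derivative \<rho> \<theta> *\<^sub>R e_th \<theta>) (at \<theta>)" for \<theta>
    using tangent by (auto intro!: derivative_eq_intros)
qed (use periodic pos cont in auto)

lemma has_integral_e_r_period: "((\<lambda>\<theta>. (x \<bullet> e_r \<theta>) * \<rho> \<theta>) has_integral 0) {0..2*pi}"
  using has_integral_e_r[of 0 "2*pi" x] periodic[of 0] by simp

text \<open>Moving the origin to an interior point makes the support function positive and leaves \<open>\<rho>\<close> alone; the
  correction term integrates to \<open>0\<close> over a period.\<close>
theorem measure_region: "measure lebesgue region = integral {0..2*pi} (\<lambda>\<theta>. h \<theta> * \<rho> \<theta>) / 2"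
proof -
  obtain x where x: "x \<in> region" using region_nonempty by blast
  interpret t: oval "\<lambda>\<theta>. c \<theta> - x" \<rho> by (rule oval_translate)
  have th: "t.h \<theta> = h \<theta> - x \<bullet> e_r \<theta>" for \<theta>
    by (simp add: t.h_def h_def inner_diff_left)
  have "region = (+) x ` t.region"
  proof (intro equalityI subsetI)
    fix y assume "y \<in> region"
    then show "y \<in> (+) x ` t.region"
      by (intro image_eqI[of _ _ "y - x"]) (auto simp: region_def t.region_def th inner_diff_left)
  qed (auto simp: region_def t.region_def th inner_add_left algebra_simps)
  then have "measure lebesgue region = measure lebesgue t.region"
    by (simp add: measure_translation)
  also have "\<dots> = integral {0..2*pi} (\<lambda>\<theta>. t.h \<theta> * \<rho> \<theta>) / 2"
    using x by (intro t.measure_region_star) (simp add: th region_def)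
  also have "integral {0..2*pi} (\<lambda>\<theta>. t.h \<theta> * \<rho> \<theta>) = integral {0..2*pi} (\<lambda>\<theta>. h \<theta> * \<rho> \<theta> - (x \<bullet> e_r \<theta>) * \<rho> \<theta>)"
    by (simp add: th left_diff_distrib)
  also have "\<dots> = integral {0..2*pi} (\<lambda>\<theta>. h \<theta> * \<rho> \<theta>) - 0"
  proof -
    have "(\<lambda>\<theta>. h \<theta> * \<rho> \<theta>) integrable_on {0..2*pi}"
      by (intro integrable_continuous_interval continuous_intros h_continuous \<rho>_continuous)
    then show ?thesis
      by (intro integral_unique has_integral_diff has_integral_e_r_period integrable_integral)
  qed
  finally show ?thesis by simp
qed

end

section \<open>Wirtinger's inequality over half a turn\<close>

text \<open>At a zero of \<open>sin (t - u)\<close> the default value \<open>cot = 0\<close> is the right one: near it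
  \<open>g\<^sup>2 cot = g cos (g / sin)\<close>, where the first factor tends to \<open>0\<close> and the quotient stays bounded.\<close>
lemma isCont_sq_cot:
  fixes g :: "real \<Rightarrow> real"
  assumes der: "(g has_real_derivative d) (at t)"
    and zero: "sin (t - u) = 0 \<Longrightarrow> g t = 0"
  shows "isCont (\<lambda>t. (g t)\<^sup>2 * cot (t - u)) t"
proof (cases "sin (t - u) = 0")
  case False
  then show ?thesis
    using DERIV_isCont[OF der] by (auto simp: cot_def intro!: continuous_intros)
next
  case True
  have cos0: "cos (t - u) \<noteq> 0" using True sin_cos_squared_add[of "t - u"] by auto
  have "((\<lambda>v. (g v - g t) / (v - t)) \<longlongrightarrow> d) (at t)"
    using der by (simp add: has_field_derivative_iff)
  moreover have "((\<lambda>v. (sin (v - u) - sin (t - u)) / (v - t)) \<longlongrightarrow> cos (t - u)) (at t)"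
  proof -
    have "((\<lambda>v. sin (v - u)) has_real_derivative cos (t - u)) (at t)"
      by (auto intro!: derivative_eq_intros)
    then show ?thesis by (simp add: has_field_derivative_iff)
  qed
  ultimately have "((\<lambda>v. ((g v - g t) / (v - t)) / ((sin (v - u) - sin (t - u)) / (v - t))) \<longlongrightarrow> d / cos (t - u)) (at t)"
    using cos0 by (intro tendsto_divide)
  moreover have "\<forall>\<^sub>F v in at t. ((g v - g t) / (v - t)) / ((sin (v - u) - sin (t - u)) / (v - t)) = g v / sin (v - u)"
    by (rule eventually_mono[OF eventually_neq_at_within[of t]]) (simp add: zero[OF True] True)
  ultimately have "((\<lambda>v. g v / sin (v - u)) \<longlongrightarrow> d / cos (t - u)) (at t)"
    by (rule Lim_transform_eventually)
  moreover have "(g \<longlongrightarrow> 0) (at t)"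
    using DERIV_isCont[OF der] zero[OF True] by (simp add: isCont_def)
  moreover have "((\<lambda>v. cos (v - u)) \<longlongrightarrow> cos (t - u)) (at t)"
    by (intro tendsto_intros)
  ultimately have "((\<lambda>v. g v * cos (v - u) * (g v / sin (v - u))) \<longlongrightarrow> 0 * cos (t - u) * (d / cos (t - u))) (at t)"
    by (intro tendsto_mult)
  then show ?thesis
    by (simp add: isCont_def cot_def zero[OF True] power2_eq_square mult_ac)
qed

text \<open>With \<open>G = g\<^sup>2 cot (t - u)\<close> one has \<open>g1\<^sup>2 - g\<^sup>2 = G' + (g1 - g cot (t - u))\<^sup>2 \<ge> G'\<close> in the interior away from \<open>u\<close>,
  and \<open>G\<close> is continuous at the zero \<open>u\<close> of \<open>g\<close>. As \<open>cot\<close> has period \<open>pi\<close> and \<open>g\<close> agrees at the ends of the interval,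
  the boundary terms of \<open>G\<close> cancel.\<close>
lemma wirtinger_antiperiod:
  fixes g :: "real \<Rightarrow> real"
  assumes der: "\<And>t. (g has_real_derivative g1 t) (at t)"
    and cont: "continuous_on UNIV g1"
    and u: "u \<in> {s..s+pi}" "g u = 0" and ends: "g (s + pi) = g s"
  shows "integral {s..s+pi} (\<lambda>t. (g t)\<^sup>2 - (g1 t)\<^sup>2) \<le> 0"
proof -
  define G where "G t = (g t)\<^sup>2 * cot (t - u)" for t
  have contf: "continuous_on S (\<lambda>t. (g1 t)\<^sup>2 - (g t)\<^sup>2)" for S
    by (intro continuous_intros continuous_on_deriv[OF der] continuous_on_subset[OF cont]) auto
  obtain V where V: "\<And>t. t \<in> {s..s+pi} \<Longrightarrow>
      (V has_vector_derivative (g1 t)\<^sup>2 - (g t)\<^sup>2) (at t within {s..s+pi})"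
    using antiderivative_continuous[OF contf] by blast
  have V_at: "(V has_real_derivative (g1 t)\<^sup>2 - (g t)\<^sup>2) (at t)" if "s < t" "t < s + pi" for t
    using V[of t] that by (simp add: at_within_Icc_at has_real_derivative_iff_has_vector_derivative)
  have V_cont: "continuous_on {s..s+pi} V"
    unfolding continuous_on_eq_continuous_within using V has_vector_derivative_continuous by blast
  have sin_nz: "sin (t - u) \<noteq> 0" if "s < t" "t < s + pi" "t \<noteq> u" for t
    using sin_gt_zero[of "t - u"] sin_gt_zero[of "u - t"] that u(1) sin_minus[of "t - u"]
    by (cases "t < u") auto
  \<comment> \<open>If the cotangent is singular at an end point of the interval, \<open>u\<close> is an end point too, and \<open>g\<close>
    vanishes at both ends.\<close>
  have g_zero: "g t = 0" if "t \<in> {s..s+pi}" "sin (t - u) = 0" for t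
  proof -
    have "t = u \<or> t = s \<or> t = s + pi" using sin_nz[of t] that by force
    moreover have "u = s \<or> u = s + pi" if "t \<noteq> u" "t = s \<or> t = s + pi"
    proof (rule ccontr)
      assume "\<not> ?thesis"
      then have "sin (u - s) > 0" "sin (s + pi - u) > 0" using u(1) by (auto intro!: sin_gt_zero)
      then show False using \<open>sin (t - u) = 0\<close> that(2) sin_minus[of "u - s"] by auto
    qed
    ultimately show ?thesis using u(2) ends by metis
  qed
  have G_cont: "continuous_on {s..s+pi} G"
    unfolding G_def by (intro continuous_at_imp_continuous_on ballI isCont_sq_cot[OF der] g_zero)
  have G_der: "(G has_real_derivative (g1 t)\<^sup>2 - (g t)\<^sup>2 - (g1 t - g t * cot (t - u))\<^sup>2) (at t)"
    if "sin (t - u) \<noteq> 0" for t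
  proof -
    have "1 / (sin (t - u))\<^sup>2 = 1 + (cot (t - u))\<^sup>2"
      using that by (simp add: cot_def power_divide field_simps)
    then have "inverse ((sin (t - u))\<^sup>2) = 1 + (cot (t - u))\<^sup>2" by (simp add: inverse_eq_divide)
    moreover have "((\<lambda>t. cot (t - u)) has_real_derivative - inverse ((sin (t - u))\<^sup>2) * 1) (at t)"
      by (rule DERIV_chain2[where f = cot and g = "\<lambda>t. t - u"], rule DERIV_cot[OF that])
        (auto intro!: derivative_eq_intros)
    ultimately have "((\<lambda>t. cot (t - u)) has_real_derivative - (1 + (cot (t - u))\<^sup>2)) (at t)"
      by simp
    then show ?thesis
      unfolding G_def
      by (auto intro!: derivative_eq_intros der simp: algebra_simps power2_eq_square)
  qed
  have mono: "V x - G x \<le> V y - G y" if "s \<le> x" "x \<le> y" "y \<le> s + pi" "u \<notin> {x<..<y}" for x y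
  proof (rule DERIV_nonneg_imp_increasing_open[of x y "\<lambda>t. V t - G t"])
    fix t assume "x < t" "t < y"
    then have "s < t" "t < s + pi" "t \<noteq> u" using that by auto
    then have "((\<lambda>t. V t - G t) has_real_derivative (g1 t - g t * cot (t - u))\<^sup>2) (at t)"
      using V_at[of t] G_der[OF sin_nz] by (auto intro!: derivative_eq_intros)
    then show "\<exists>d. ((\<lambda>t. V t - G t) has_real_derivative d) (at t) \<and> d \<ge> 0" by force
  next
    show "continuous_on {x..y} (\<lambda>t. V t - G t)"
      by (intro continuous_intros continuous_on_subset[OF V_cont] continuous_on_subset[OF G_cont])
        (use that in auto)
  qed (use that in auto)
  have "cot (s + pi - u) = cot (s - u)"
    using sin_periodic_pi[of "s - u"] cos_periodic_pi[of "s - u"]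
    by (simp add: cot_def algebra_simps)
  then have "G (s + pi) = G s" by (simp add: G_def ends)
  moreover have "V s - G s \<le> V (s + pi) - G (s + pi)"
    using mono[of s u] mono[of u "s + pi"] u(1) by auto
  moreover have "((\<lambda>t. (g1 t)\<^sup>2 - (g t)\<^sup>2) has_integral V (s + pi) - V s) {s..s+pi}"
    by (intro fundamental_theorem_of_calculus V) auto
  ultimately have "integral {s..s+pi} (\<lambda>t. (g1 t)\<^sup>2 - (g t)\<^sup>2) \<ge> 0"
    by (simp add: integral_unique)
  moreover have "integral {s..s+pi} (\<lambda>t. (g t)\<^sup>2 - (g1 t)\<^sup>2) = - integral {s..s+pi} (\<lambda>t. (g1 t)\<^sup>2 - (g t)\<^sup>2)"
    unfolding integral_neg[symmetric] by simp
  ultimately show ?thesis by simp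
qed

text \<open>Wirtinger's inequality for \<open>a t * f - f t * a\<close>, which vanishes at \<open>t\<close>, expanded as a quadratic form.\<close>
lemma half_turn_bonnesen:
  fixes f a :: "real \<Rightarrow> real"
  assumes f: "\<And>t. (f has_real_derivative f1 t) (at t)" "continuous_on UNIV f1" "f (s + pi) = f s"
    and a: "\<And>t. (a has_real_derivative a1 t) (at t)" "continuous_on UNIV a1" "a (s + pi) = a s"
    and t: "t \<in> {s..s+pi}"
  defines "form \<equiv> \<lambda>u u1 v v1. integral {s..s+pi} (\<lambda>t. u t * v t - u1 t * v1 t)"
  shows "form f f1 f f1 * (a t)\<^sup>2 - 2 * form f f1 a a1 * f t * a t + form a a1 a a1 * (f t)\<^sup>2 \<le> 0"
proof -
  have int: "((\<lambda>x. u x * v x - u1 x * v1 x) has_integral form u u1 v v1) {s..s+pi}"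
    if "\<And>t. (u has_real_derivative u1 t) (at t)" "continuous_on UNIV u1"
      "\<And>t. (v has_real_derivative v1 t) (at t)" "continuous_on UNIV v1" for u u1 v v1
    unfolding form_def
    by (intro integrable_integral integrable_continuous_interval continuous_intros
        continuous_on_deriv[OF that(1)] continuous_on_deriv[OF that(3)]
        continuous_on_subset[OF that(2)] continuous_on_subset[OF that(4)]) auto
  let ?g = "\<lambda>x. a t * f x - f t * a x" and ?g1 = "\<lambda>x. a t * f1 x - f t * a1 x"
  have "integral {s..s+pi} (\<lambda>x. (?g x)\<^sup>2 - (?g1 x)\<^sup>2) \<le> 0"
    using t f(2,3) a(2,3)
    by (intro wirtinger_antiperiod[where u = t]) (auto intro!: derivative_eq_intros continuous_intros f(1) a(1))
  moreover have "((\<lambda>x. (a t)\<^sup>2 * (f x * f x - f1 x * f1 x) - 2 * f t * a t * (f x * a x - f1 x * a1 x)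
      + (f t)\<^sup>2 * (a x * a x - a1 x * a1 x)) has_integral
      ((a t)\<^sup>2 * form f f1 f f1 - 2 * f t * a t * form f f1 a a1 + (f t)\<^sup>2 * form a a1 a a1)) {s..s+pi}"
    by (intro has_integral_add has_integral_diff has_integral_mult_right int f a)
  moreover have "(\<lambda>x. (?g x)\<^sup>2 - (?g1 x)\<^sup>2) = (\<lambda>x. (a t)\<^sup>2 * (f x * f x - f1 x * f1 x)
      - 2 * f t * a t * (f x * a x - f1 x * a1 x) + (f t)\<^sup>2 * (a x * a x - a1 x * a1 x))"
    by (auto simp: power2_eq_square algebra_simps)
  ultimately show ?thesis by (simp add: integral_unique mult_ac)
qed

lemma integral_periodic_shift:
  fixes f :: "real \<Rightarrow> real"
  assumes "continuous_on UNIV f" "\<And>t. f (t + 2*pi) = f t" "0 \<le> s" "s \<le> 2*pi"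
  shows "integral {s..s+2*pi} f = integral {0..2*pi} f"
proof -
  have int: "f integrable_on {x..y}" for x y
    by (intro integrable_continuous_interval continuous_on_subset[OF assms(1)]) auto
  have "integral {0..s} (f \<circ> (+) (2*pi)) = integral {0+2*pi..s+2*pi} f"
    by (rule integral_shift_Icc_real)
  moreover have "f \<circ> (+) (2*pi) = f" using assms(2) by (auto simp: add.commute)
  ultimately have "integral {2*pi..s+2*pi} f = integral {0..s} f" by simp
  moreover have "integral {0..s} f + integral {s..2*pi} f = integral {0..2*pi} f"
    "integral {s..2*pi} f + integral {2*pi..s+2*pi} f = integral {s..s+2*pi} f"
    using assms by (auto intro!: Henstock_Kurzweil_Integration.integral_combine int)
  ultimately show ?thesis by simp
qed

lemma integral_half_period:
  fixes f :: "real \<Rightarrow> real"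
  assumes "continuous_on UNIV f" "\<And>t. f (t + pi) = f t" "0 \<le> s" "s \<le> 2*pi"
  shows "integral {s..s+pi} f = integral {0..2*pi} f / 2"
proof -
  have int: "f integrable_on {x..y}" for x y
    by (intro integrable_continuous_interval continuous_on_subset[OF assms(1)]) auto
  have p2: "f (t + 2*pi) = f t" for t
    using assms(2)[of t] assms(2)[of "t + pi"] by (simp add: add.assoc)
  have "integral {s..s+pi} (f \<circ> (+) pi) = integral {s+pi..s+pi+pi} f"
    by (rule integral_shift_Icc_real)
  moreover have "f \<circ> (+) pi = f" using assms(2) by (auto simp: add.commute)
  moreover have "integral {s..s+pi} f + integral {s+pi..s+pi+pi} f = integral {s..s+pi+pi} f"
    by (intro Henstock_Kurzweil_Integration.integral_combine int) auto
  moreover have "integral {s..s+2*pi} f = integral {0..2*pi} f"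
    by (rule integral_periodic_shift[OF assms(1) p2 assms(3,4)])
  moreover have "s + pi + pi = s + 2*pi" by simp
  ultimately show ?thesis by simp
qed

context oval
begin

text \<open>Since \<open>\<rho> = h + h''\<close>, integrating by parts trades the curvature radius for first derivatives.\<close>
lemma has_integral_by_parts:
  assumes "s \<le> t" "\<And>\<theta>. (f has_real_derivative f1 \<theta>) (at \<theta>)" "continuous_on UNIV f1"
  shows "((\<lambda>\<theta>. f \<theta> * \<rho> \<theta>) has_integral
      integral {s..t} (\<lambda>\<theta>. f \<theta> * h \<theta> - f1 \<theta> * h1 \<theta>) + (f t * h1 t - f s * h1 s)) {s..t}"
proof -
  have "((\<lambda>\<theta>. f \<theta> * h1 \<theta>) has_real_derivative f1 \<theta> * h1 \<theta> + f \<theta> * (\<rho> \<theta> - h \<theta>)) (at \<theta>)" for \<theta>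
    by (auto intro!: derivative_eq_intros assms(2) h1_deriv)
  then have "((\<lambda>\<theta>. f1 \<theta> * h1 \<theta> + f \<theta> * (\<rho> \<theta> - h \<theta>)) has_integral f t * h1 t - f s * h1 s) {s..t}"
    by (rule has_integral_deriv[OF assms(1)])
  moreover have "((\<lambda>\<theta>. f \<theta> * h \<theta> - f1 \<theta> * h1 \<theta>) has_integral
      integral {s..t} (\<lambda>\<theta>. f \<theta> * h \<theta> - f1 \<theta> * h1 \<theta>)) {s..t}"
    by (intro integrable_integral integrable_continuous_interval continuous_intros h_continuous
        h1_continuous continuous_on_deriv[OF assms(2)] continuous_on_subset[OF assms(3)]) auto
  ultimately have "((\<lambda>\<theta>. (f \<theta> * h \<theta> - f1 \<theta> * h1 \<theta>) + (f1 \<theta> * h1 \<theta> + f \<theta> * (\<rho> \<theta> - h \<theta>))) has_integral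
      integral {s..t} (\<lambda>\<theta>. f \<theta> * h \<theta> - f1 \<theta> * h1 \<theta>) + (f t * h1 t - f s * h1 s)) {s..t}"
    using has_integral_add by blast
  then show ?thesis by (simp add: algebra_simps)
qed

end

section \<open>Gage's inequality for an oval and a symmetric unit ball\<close>

text \<open>The oval \<open>c\<close> is the curve under study and the centrally symmetric oval \<open>p\<close> the boundary of the unit
  ball. Taking \<open>c = p\<close> is allowed and yields the facts about the ball alone.\<close>
locale ball_and_oval = oval c \<rho> + P: oval p \<sigma> for c \<rho> p \<sigma> +
  assumes antipodal: "p (\<theta> + pi) = - p \<theta>"
begin

abbreviation "a \<equiv> P.h"
abbreviation "a1 \<equiv> P.h1"

lemma a_antipodal: "a (\<theta> + pi) = a \<theta>" and a1_antipodal: "a1 (\<theta> + pi) = a1 \<theta>"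
  by (simp_all add: P.h_def P.h1_def antipodal)

lemma \<sigma>_antipodal: "\<sigma> (\<theta> + pi) = \<sigma> \<theta>"
proof -
  have "((\<lambda>t. a1 (t + pi)) has_real_derivative \<sigma> (\<theta> + pi) - a (\<theta> + pi)) (at \<theta>)"
    by (subst DERIV_shift[symmetric]) (rule P.h1_deriv)
  moreover have "(\<lambda>t. a1 (t + pi)) = a1" by (simp add: a1_antipodal)
  ultimately have "\<sigma> (\<theta> + pi) - a (\<theta> + pi) = \<sigma> \<theta> - a \<theta>"
    using P.h1_deriv DERIV_unique by metis
  then show ?thesis by (simp add: a_antipodal)
qed

lemma a_pos: "a \<theta> > 0"
  using P.height_strict[of \<theta> "\<theta> + pi"] by (simp add: P.h_def antipodal)

lemma a_neq0 [simp]: "a \<theta> \<noteq> 0"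
  using a_pos[of \<theta>] by simp

definition "ball_area = integral {0..2*pi} (\<lambda>\<theta>. a \<theta> * \<sigma> \<theta>) / 2"
definition "area = integral {0..2*pi} (\<lambda>\<theta>. h \<theta> * \<rho> \<theta>) / 2"
definition "len = integral {0..2*pi} (\<lambda>\<theta>. a \<theta> * \<rho> \<theta>)"

lemma ball_area_pos: "ball_area > 0"
proof -
  have "continuous_on {0..2*pi} (\<lambda>\<theta>. a \<theta> * \<sigma> \<theta>)"
    by (intro continuous_intros P.h_continuous P.\<rho>_continuous)
  then have "integral {0..2*pi} (\<lambda>\<theta>. 0) < integral {0..2*pi} (\<lambda>\<theta>. a \<theta> * \<sigma> \<theta>)"
    using a_pos P.pos by (intro integral_less_real) (simp_all add: greaterThanLessThan_empty_iff not_le)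
  then show ?thesis by (simp add: ball_area_def)
qed

lemma len_pos: "len > 0"
proof -
  have "continuous_on {0..2*pi} (\<lambda>\<theta>. a \<theta> * \<rho> \<theta>)"
    by (intro continuous_intros P.h_continuous \<rho>_continuous)
  then have "integral {0..2*pi} (\<lambda>\<theta>. 0) < integral {0..2*pi} (\<lambda>\<theta>. a \<theta> * \<rho> \<theta>)"
    using a_pos pos by (intro integral_less_real) (simp_all add: greaterThanLessThan_empty_iff not_le)
  then show ?thesis by (simp add: len_def)
qed

text \<open>This is the case in which the chord from \<open>c s\<close> to \<open>c (s + pi)\<close> has its midpoint at the origin. The
  Bonnesen inequality says \<open>D \<ge> 0\<close>; integrating \<open>D \<rho> / a\<close> gives the bound. If the integral is \<open>0\<close>, so is \<open>D\<close>,
  and \<open>h / a\<close> takes at most two values on the interval, the roots of a quadratic polynomial.\<close>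
lemma half_turn_gage:
  assumes chord: "c (s + pi) = - c s" and s: "0 \<le> s" "s \<le> 2*pi"
  defines "Ah \<equiv> integral {s..s+pi} (\<lambda>\<theta>. h \<theta> * \<rho> \<theta>)"
    and "Lh \<equiv> integral {s..s+pi} (\<lambda>\<theta>. a \<theta> * \<rho> \<theta>)"
    and "m \<equiv> integral {s..s+pi} (\<lambda>\<theta>. (h \<theta>)\<^sup>2 / a \<theta> * \<rho> \<theta>)"
  shows "ball_area * m \<le> Lh * Ah"
    and "ball_area * m = Lh * Ah \<Longrightarrow> \<exists>r. \<forall>t\<in>{s..s+pi}. h t = r * a t"
proof -
  define D where "D t = 2 * Lh * h t * a t - Ah * (a t)\<^sup>2 - ball_area * (h t)\<^sup>2" for t
  have hs: "h (s + pi) = h s" "h1 (s + pi) = h1 s" by (simp_all add: h_def h1_def chord)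
  have h1c: "continuous_on UNIV h1" "continuous_on UNIV a1" by (rule h1_continuous P.h1_continuous)+
  have 1: "integral {s..s+pi} (\<lambda>\<theta>. h \<theta> * h \<theta> - h1 \<theta> * h1 \<theta>) = Ah"
    using has_integral_by_parts[OF _ h_deriv h1c(1), of s "s + pi"] by (simp add: Ah_def hs integral_unique)
  have 2: "integral {s..s+pi} (\<lambda>\<theta>. h \<theta> * a \<theta> - h1 \<theta> * a1 \<theta>) = Lh"
    using has_integral_by_parts[OF _ P.h_deriv h1c(2), of s "s + pi"]
    by (simp add: Lh_def hs integral_unique a_antipodal mult.commute)
  have "integral {s..s+pi} (\<lambda>\<theta>. a \<theta> * a \<theta> - a1 \<theta> * a1 \<theta>) = integral {s..s+pi} (\<lambda>\<theta>. a \<theta> * \<sigma> \<theta>)"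
    using P.has_integral_by_parts[OF _ P.h_deriv h1c(2), of s "s + pi"]
    by (simp add: integral_unique a_antipodal a1_antipodal)
  also have "\<dots> = ball_area"
    unfolding ball_area_def
    by (intro integral_half_period continuous_intros P.h_continuous P.\<rho>_continuous s)
      (simp add: a_antipodal \<sigma>_antipodal)
  finally have 3: "integral {s..s+pi} (\<lambda>\<theta>. a \<theta> * a \<theta> - a1 \<theta> * a1 \<theta>) = ball_area" .
  have D_nonneg: "D t \<ge> 0" if "t \<in> {s..s+pi}" for t
    using half_turn_bonnesen[OF h_deriv h1c(1) hs(1) P.h_deriv h1c(2) a_antipodal that]
    unfolding 1 2 3 D_def by simp
  have cont: "continuous_on {s..s+pi} (\<lambda>\<theta>. D \<theta> / a \<theta> * \<rho> \<theta>)"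
    unfolding D_def
    by (intro continuous_intros h_continuous P.h_continuous \<rho>_continuous) auto
  have "((\<lambda>\<theta>. 2 * Lh * (h \<theta> * \<rho> \<theta>) - Ah * (a \<theta> * \<rho> \<theta>) - ball_area * ((h \<theta>)\<^sup>2 / a \<theta> * \<rho> \<theta>)) has_integral
      (2 * Lh * Ah - Ah * Lh - ball_area * m)) {s..s+pi}"
    unfolding Ah_def Lh_def m_def
    by (intro has_integral_diff has_integral_mult_right integrable_integral integrable_continuous_interval
        continuous_intros h_continuous P.h_continuous \<rho>_continuous) auto
  moreover have "(\<lambda>\<theta>. 2 * Lh * (h \<theta> * \<rho> \<theta>) - Ah * (a \<theta> * \<rho> \<theta>) - ball_area * ((h \<theta>)\<^sup>2 / a \<theta> * \<rho> \<theta>))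
      = (\<lambda>\<theta>. D \<theta> / a \<theta> * \<rho> \<theta>)"
    by (auto simp: D_def field_simps power2_eq_square)
  ultimately have D_int: "integral {s..s+pi} (\<lambda>\<theta>. D \<theta> / a \<theta> * \<rho> \<theta>) = Lh * Ah - ball_area * m"
    by (simp add: integral_unique algebra_simps)
  have nonneg: "D t / a t * \<rho> t \<ge> 0" if "t \<in> {s..s+pi}" for t
    using D_nonneg[OF that] a_pos[of t] pos[of t] by simp
  have "integral {s..s+pi} (\<lambda>\<theta>. D \<theta> / a \<theta> * \<rho> \<theta>) \<ge> 0"
    by (rule integral_nonneg[OF integrable_continuous_interval[OF cont] nonneg])
  then show "ball_area * m \<le> Lh * Ah" using D_int by simp
  assume "ball_area * m = Lh * Ah"
  then have "integral {s..s+pi} (\<lambda>\<theta>. D \<theta> / a \<theta> * \<rho> \<theta>) = 0" using D_int by simp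
  then have D0: "D t = 0" if "t \<in> {s..s+pi}" for t
    using integral_eq_0_iff[OF cont _ nonneg] that pos[of t] by auto
  define u where "u t = h t / a t" for t
  define d where "d = Lh\<^sup>2 - ball_area * Ah"
  have root: "u t \<in> {(Lh + sqrt d) / ball_area, (Lh - sqrt d) / ball_area}" if "t \<in> {s..s+pi}" for t
  proof -
    have "h t = u t * a t" by (simp add: u_def)
    then have "(a t)\<^sup>2 * (2 * Lh * u t - Ah - ball_area * (u t)\<^sup>2) = 0"
      using D0[OF that] by (simp add: D_def algebra_simps power2_eq_square)
    then have "2 * Lh * u t - Ah - ball_area * (u t)\<^sup>2 = 0" by simp
    then have "ball_area * (2 * Lh * u t - Ah - ball_area * (u t)\<^sup>2) = 0" by simp
    then have sq: "(ball_area * u t - Lh)\<^sup>2 = d"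
      by (simp add: d_def power2_eq_square algebra_simps)
    then have "\<bar>ball_area * u t - Lh\<bar> = sqrt d" by (metis real_sqrt_abs)
    then have "ball_area * u t = Lh + sqrt d \<or> ball_area * u t = Lh - sqrt d" by linarith
    then show ?thesis using ball_area_pos by (auto simp: field_simps)
  qed
  have "u constant_on {s..s+pi}"
  proof (rule continuous_finite_range_constant)
    show "continuous_on {s..s+pi} u"
      unfolding u_def by (intro continuous_intros h_continuous P.h_continuous) auto
    show "finite (u ` {s..s+pi})" by (rule finite_subset[OF image_subsetI[OF root]]) auto
  qed auto
  then obtain r where "\<And>t. t \<in> {s..s+pi} \<Longrightarrow> u t = r" by (auto simp: constant_on_def)
  then have "h t = r * a t" if "t \<in> {s..s+pi}" for t
    using that by (metis a_neq0 nonzero_divide_eq_eq u_def)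
  then show "\<exists>r. \<forall>t\<in>{s..s+pi}. h t = r * a t" by blast
qed

lemma translate: "ball_and_oval (\<lambda>\<theta>. c \<theta> - x) \<rho> p \<sigma>"
  by (intro ball_and_oval.intro oval_translate P.oval_axioms ball_and_oval_axioms.intro antipodal)

lemma translate_h: "oval.h (\<lambda>\<theta>. c \<theta> - x) \<theta> = h \<theta> - x \<bullet> e_r \<theta>"
  unfolding oval.h_def[OF oval_translate] by (simp add: h_def inner_diff_left)

text \<open>Let \<open>S s\<close> be the contribution of the half turn that starts at \<open>s\<close>, measured from the midpoint of the
  chord. The chords for \<open>s = 0\<close> and \<open>s = pi\<close> coincide and their half turns are complementary, so
  \<open>S 0 + S pi = 2 * area\<close>. By continuity \<open>S\<close> takes the value \<open>area\<close> in between.\<close>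
lemma area_bisecting_chord:
  obtains s x where "0 \<le> s" "s \<le> pi" "c s - x = - (c (s + pi) - x)"
    "integral {s..s+pi} (\<lambda>\<theta>. (h \<theta> - x \<bullet> e_r \<theta>) * \<rho> \<theta>) = area"
    "integral {s+pi..s+2*pi} (\<lambda>\<theta>. (h \<theta> - x \<bullet> e_r \<theta>) * \<rho> \<theta>) = area"
proof -
  define x where "x s = (1/2) *\<^sub>R (c s + c (s + pi))" for s
  define V where "V t = integral {0..t} (\<lambda>\<theta>. h \<theta> * \<rho> \<theta>)" for t
  define w where "w s = (vector [- x s $ 2, x s $ 1] :: real^2)" for s
  define S where "S s = V (s + pi) - V s - (c (s + pi) - c s) \<bullet> w s" for s
  have hint: "(\<lambda>\<theta>. h \<theta> * \<rho> \<theta>) integrable_on {s..t}" for s t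
    by (intro integrable_continuous_interval continuous_intros h_continuous \<rho>_continuous)
  have V_diff: "integral {s..t} (\<lambda>\<theta>. h \<theta> * \<rho> \<theta>) = V t - V s" if "0 \<le> s" "s \<le> t" for s t
    unfolding V_def using Henstock_Kurzweil_Integration.integral_combine[OF that hint] by simp
  have part: "integral {s..t} (\<lambda>\<theta>. (h \<theta> - x r \<bullet> e_r \<theta>) * \<rho> \<theta>) = V t - V s - (c t - c s) \<bullet> w r"
    if "0 \<le> s" "s \<le> t" for s t r
  proof -
    have "((\<lambda>\<theta>. h \<theta> * \<rho> \<theta> - (x r \<bullet> e_r \<theta>) * \<rho> \<theta>) has_integral (V t - V s - (c t - c s) \<bullet> w r)) {s..t}"
      unfolding w_def V_diff[OF that, symmetric] using that
      by (intro has_integral_diff has_integral_e_r integrable_integral hint)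
    then show ?thesis by (simp add: left_diff_distrib integral_unique)
  qed
  have p2: "c (s + pi + pi) = c s" for s using periodic[of s] by (simp add: add.assoc)
  have total: "V (s + 2*pi) - V s = 2 * area" if "0 \<le> s" "s \<le> 2*pi" for s
    using integral_periodic_shift[of "\<lambda>\<theta>. h \<theta> * \<rho> \<theta>" s] that V_diff[of s "s + 2*pi"]
    by (simp add: area_def h_periodic \<rho>_periodic continuous_on_mult h_continuous \<rho>_continuous)
  have "continuous_on {0..3*pi} V"
    unfolding V_def by (rule indefinite_integral_continuous_1[OF hint])
  moreover have "{0..pi} \<subseteq> {0..3*pi}" "(\<lambda>s. s + pi) ` {0..pi} \<subseteq> {0..3*pi}" by auto
  ultimately have Vc: "continuous_on {0..pi} V" "continuous_on {0..pi} (\<lambda>s. V (s + pi))"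
    using continuous_on_subset continuous_on_compose2[of "{0..3*pi}" V "{0..pi}" "\<lambda>s. s + pi"]
    by (blast, simp add: continuous_on_add)
  have cc: "continuous_on {0..pi} (\<lambda>s. c (s + pi))"
    by (rule continuous_on_compose2[OF c_continuous[of UNIV]]) (auto intro!: continuous_intros)
  have w_nth: "w s = (x s $ 1) *\<^sub>R axis 2 1 + (- x s $ 2) *\<^sub>R axis 1 1" for s
    by (simp add: w_def vec_eq_iff forall_2 axis_def)
  have "continuous_on {0..pi} S"
    unfolding S_def w_nth x_def by (intro continuous_intros Vc cc c_continuous)
  moreover have "S 0 + S pi = 2 * area"
  proof -
    have "x pi = x 0" using periodic[of 0] by (simp add: x_def add.commute)
    then have "w pi = w 0" by (simp add: w_def)
    then show ?thesis
      using total[of 0] periodic[of 0] by (simp add: S_def inner_diff_left algebra_simps)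
  qed
  ultimately obtain s where s: "0 \<le> s" "s \<le> pi" "S s = area"
    using IVT'[of S 0 area pi] IVT2'[of S pi area 0] by (cases "S 0 \<le> area") force+
  show ?thesis
  proof (rule that[of s "x s"])
    show "c s - x s = - (c (s + pi) - x s)"
      by (simp add: x_def vec_eq_iff field_simps)
    show "integral {s..s+pi} (\<lambda>\<theta>. (h \<theta> - x s \<bullet> e_r \<theta>) * \<rho> \<theta>) = area"
      using s by (simp add: part S_def)
    have "integral {s+pi..s+2*pi} (\<lambda>\<theta>. (h \<theta> - x s \<bullet> e_r \<theta>) * \<rho> \<theta>)
        = V (s + 2*pi) - V (s + pi) - (c s - c (s + pi)) \<bullet> w s"
      using s by (simp add: part periodic)
    also have "\<dots> = area" using s total[of s] by (simp add: S_def inner_diff_left)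
    finally show "integral {s+pi..s+2*pi} (\<lambda>\<theta>. (h \<theta> - x s \<bullet> e_r \<theta>) * \<rho> \<theta>) = area" .
  qed (use s in auto)
qed

text \<open>The second moment about \<open>x\<close> of the relative support function \<open>(h - x \<bullet> e_r) / a\<close> with respect to the
  arc length element \<open>a \<rho> d\<theta>\<close>.\<close>
definition "moment x = integral {0..2*pi} (\<lambda>\<theta>. (h \<theta> - x \<bullet> e_r \<theta>)\<^sup>2 / a \<theta> * \<rho> \<theta>)"

lemma homothetic_if_support:
  assumes "\<And>\<theta>. h \<theta> - x \<bullet> e_r \<theta> = r * a \<theta>"
  shows "c \<theta> = x + r *\<^sub>R p \<theta>" and "r > 0"
proof -
  have "((\<lambda>\<theta>. h \<theta> - x \<bullet> e_r \<theta>) has_real_derivative h1 \<theta> - x \<bullet> e_th \<theta>) (at \<theta>)"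
    using has_real_derivative_inner[OF has_vector_derivative_const e_r_deriv, of x \<theta>]
    by (auto intro!: derivative_eq_intros h_deriv)
  moreover have "((\<lambda>\<theta>. r * a \<theta>) has_real_derivative r * a1 \<theta>) (at \<theta>)"
    by (auto intro!: derivative_eq_intros P.h_deriv)
  ultimately have d: "h1 \<theta> - x \<bullet> e_th \<theta> = r * a1 \<theta>"
    using DERIV_unique by (simp add: assms) blast
  show "c \<theta> = x + r *\<^sub>R p \<theta>"
  proof -
    have "c \<theta> - x = (h \<theta> - x \<bullet> e_r \<theta>) *\<^sub>R e_r \<theta> + (h1 \<theta> - x \<bullet> e_th \<theta>) *\<^sub>R e_th \<theta>"
      using frame_expansion[of "c \<theta> - x" \<theta>] by (simp add: h_def h1_def inner_diff_left)
    also have "\<dots> = r *\<^sub>R p \<theta>"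
      unfolding assms d P.c_frame[of \<theta>] by (simp add: scaleR_add_right)
    finally show ?thesis by (simp add: algebra_simps)
  qed
  have "h \<theta> + h (\<theta> + pi) > 0"
    using height_strict[of \<theta> "\<theta> + pi"] by (simp add: h_def)
  then have "2 * (r * a \<theta>) > 0"
    using assms[of \<theta>] assms[of "\<theta> + pi"] by (simp add: a_antipodal)
  then show "r > 0" using a_pos[of \<theta>] by (simp add: zero_less_mult_iff)
qed

text \<open>Both half turns cut off by the bisecting chord are instances of \<open>half_turn_gage\<close> for the oval
  translated to the midpoint. In the case of equality the two ratios agree at the common end point.\<close>
theorem gage_inequality:
  obtains x where "ball_area * moment x \<le> len * area"
    and "ball_area * moment x = len * area \<Longrightarrow> \<exists>r>0. \<forall>\<theta>. c \<theta> = x + r *\<^sub>R p \<theta>"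
proof -
  obtain s x where s: "0 \<le> s" "s \<le> pi" and chord: "c s - x = - (c (s + pi) - x)"
    and bisect: "integral {s..s+pi} (\<lambda>\<theta>. (h \<theta> - x \<bullet> e_r \<theta>) * \<rho> \<theta>) = area"
      "integral {s+pi..s+2*pi} (\<lambda>\<theta>. (h \<theta> - x \<bullet> e_r \<theta>) * \<rho> \<theta>) = area"
    using area_bisecting_chord by blast
  interpret t: ball_and_oval "\<lambda>\<theta>. c \<theta> - x" \<rho> p \<sigma> by (rule translate)
  define M where "M i j = integral {i..j} (\<lambda>\<theta>. (h \<theta> - x \<bullet> e_r \<theta>)\<^sup>2 / a \<theta> * \<rho> \<theta>)" for i j
  define l where "l i j = integral {i..j} (\<lambda>\<theta>. a \<theta> * \<rho> \<theta>)" for i j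
  have p2: "s + pi + pi = s + 2*pi" by simp
  have c2: "c (s + pi) - x = - (c s - x)" "c (s + pi + pi) - x = - (c (s + pi) - x)"
    using chord periodic[of s] by (auto simp: p2 algebra_simps)
  have 1: "ball_area * M s (s+pi) \<le> l s (s+pi) * area"
    "ball_area * M s (s+pi) = l s (s+pi) * area \<Longrightarrow>
       \<exists>r. \<forall>t\<in>{s..s+pi}. h t - x \<bullet> e_r t = r * a t"
    using t.half_turn_gage[of s] s c2(1) bisect(1) unfolding translate_h M_def l_def by auto
  have 2: "ball_area * M (s+pi) (s+2*pi) \<le> l (s+pi) (s+2*pi) * area"
    "ball_area * M (s+pi) (s+2*pi) = l (s+pi) (s+2*pi) * area \<Longrightarrow>
       \<exists>r. \<forall>t\<in>{s+pi..s+2*pi}. h t - x \<bullet> e_r t = r * a t"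
    using t.half_turn_gage[of "s+pi"] s c2(2) bisect(2) unfolding translate_h M_def l_def p2 by auto
  have contM: "continuous_on S (\<lambda>\<theta>. (h \<theta> - x \<bullet> e_r \<theta>)\<^sup>2 / a \<theta> * \<rho> \<theta>)" for S
    by (intro continuous_intros h_continuous P.h_continuous \<rho>_continuous e_r_continuous) auto
  have contl: "continuous_on S (\<lambda>\<theta>. a \<theta> * \<rho> \<theta>)" for S
    by (intro continuous_intros P.h_continuous \<rho>_continuous)
  have "M s (s+pi) + M (s+pi) (s+2*pi) = M s (s+2*pi)"
    unfolding M_def by (intro Henstock_Kurzweil_Integration.integral_combine integrable_continuous_interval contM) auto
  also have "\<dots> = moment x"
    unfolding M_def moment_def using s
    by (intro integral_periodic_shift contM) (auto simp: h_periodic P.h_periodic \<rho>_periodic)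
  finally have M: "moment x = M s (s+pi) + M (s+pi) (s+2*pi)" ..
  have "l s (s+pi) + l (s+pi) (s+2*pi) = l s (s+2*pi)"
    unfolding l_def by (intro Henstock_Kurzweil_Integration.integral_combine integrable_continuous_interval contl) auto
  also have "\<dots> = len"
    unfolding l_def len_def using s
    by (intro integral_periodic_shift contl) (auto simp: P.h_periodic \<rho>_periodic)
  finally have l: "len = l s (s+pi) + l (s+pi) (s+2*pi)" ..
  show ?thesis
  proof (rule that[of x])
    show "ball_area * moment x \<le> len * area"
      using 1(1) 2(1) by (simp add: M l algebra_simps)
    assume "ball_area * moment x = len * area"
    then have "ball_area * M s (s+pi) = l s (s+pi) * area"
      "ball_area * M (s+pi) (s+2*pi) = l (s+pi) (s+2*pi) * area"
      using 1(1) 2(1) by (simp_all add: M l algebra_simps)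
    then obtain r r' where r: "\<And>t. t \<in> {s..s+pi} \<Longrightarrow> h t - x \<bullet> e_r t = r * a t"
      "\<And>t. t \<in> {s+pi..s+2*pi} \<Longrightarrow> h t - x \<bullet> e_r t = r' * a t"
      using 1(2) 2(2) by blast
    have "r * a (s+pi) = r' * a (s+pi)" using r(1)[of "s+pi"] r(2)[of "s+pi"] by simp
    then have "r = r'" by simp
    then have per: "h t - x \<bullet> e_r t = r * a t" if "t \<in> {s..s+2*pi}" for t
      using r[of t] that by (cases "t \<le> s + pi") auto
    have "h \<theta> - x \<bullet> e_r \<theta> = r * a \<theta>" for \<theta>
    proof -
      obtain k :: int where k: "s \<le> \<theta> + 2*pi * k" "\<theta> + 2*pi * k < s + 2*pi"
        by (rule shift_into_period)
      have "h \<theta> - x \<bullet> e_r \<theta> - r * a \<theta> = (\<lambda>\<theta>. h \<theta> - x \<bullet> e_r \<theta> - r * a \<theta>) (\<theta> + 2*pi * of_int k)"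
        by (rule periodic_int[symmetric]) (simp add: h_periodic P.h_periodic)
      then show ?thesis using per[of "\<theta> + 2*pi * of_int k"] k by simp
    qed
    then show "\<exists>r>0. \<forall>\<theta>. c \<theta> = x + r *\<^sub>R p \<theta>"
      using homothetic_if_support by blast
  qed
qed

end

section \<open>The isoperimetric defect\<close>

text \<open>For support functions, half of \<open>mixed_form f g\<close> is the mixed area of the two bodies.\<close>
definition mixed_form :: "(real \<Rightarrow> real) \<Rightarrow> (real \<Rightarrow> real) \<Rightarrow> real" where
  "mixed_form f g = integral {0..2*pi} (\<lambda>\<theta>. f \<theta> * g \<theta> - deriv f \<theta> * deriv g \<theta>)"

text \<open>For an integration functional \<open>W\<close> this is the minimum over \<open>x\<close> of the quadratic polynomial
  \<open>W (\<lambda>\<theta>. (h \<theta> - x $ 1 * cos \<theta> - x $ 2 * sin \<theta>)\<^sup>2)\<close>, obtained by solving the two linear equations for the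
  minimizer by Cramer's rule. Writing it out makes its continuous dependence on \<open>h\<close> evident.\<close>
definition least_moment :: "((real \<Rightarrow> real) \<Rightarrow> real) \<Rightarrow> (real \<Rightarrow> real) \<Rightarrow> real" where
  "least_moment W h = W (\<lambda>\<theta>. (h \<theta>)\<^sup>2)
    - (W (\<lambda>\<theta>. (sin \<theta>)\<^sup>2) * (W (\<lambda>\<theta>. h \<theta> * cos \<theta>))\<^sup>2
       - 2 * W (\<lambda>\<theta>. cos \<theta> * sin \<theta>) * W (\<lambda>\<theta>. h \<theta> * cos \<theta>) * W (\<lambda>\<theta>. h \<theta> * sin \<theta>)
       + W (\<lambda>\<theta>. (cos \<theta>)\<^sup>2) * (W (\<lambda>\<theta>. h \<theta> * sin \<theta>))\<^sup>2)
      / (W (\<lambda>\<theta>. (cos \<theta>)\<^sup>2) * W (\<lambda>\<theta>. (sin \<theta>)\<^sup>2) - (W (\<lambda>\<theta>. cos \<theta> * sin \<theta>))\<^sup>2)"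

text \<open>The functional \<open>F\<close>, as a function of the set \<open>\<gamma>\<close>. Only first derivatives of the support function
  occur, which is what Hausdorff convergence controls.\<close>
definition isoperimetric_defect :: "(real^2) set \<Rightarrow> (real^2) set \<Rightarrow> real" where
  "isoperimetric_defect P \<gamma> = (let a = support_fun P; h = support_fun \<gamma> in
     1 - mixed_form a a / 2 * least_moment (\<lambda>u. mixed_form (\<lambda>\<theta>. u \<theta> / a \<theta>) h) h
         / (mixed_form a h * (mixed_form h h / 2)))"

lemma (in oval) mixed_form_h:
  assumes "\<And>\<theta>. (f has_real_derivative f1 \<theta>) (at \<theta>)" "continuous_on UNIV f1" "f (2*pi) = f 0"
  shows "mixed_form f h = integral {0..2*pi} (\<lambda>\<theta>. f \<theta> * \<rho> \<theta>)"
proof -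
  have "deriv f = f1" "deriv h = h1"
    using assms(1) h_deriv by (auto intro!: DERIV_imp_deriv)
  moreover have "h1 (2*pi) = h1 0" using h1_periodic[of 0] by simp
  ultimately show ?thesis
    using has_integral_by_parts[OF _ assms(1,2), of 0 "2*pi"] assms(3)
    by (simp add: mixed_form_def integral_unique)
qed

text \<open>The discriminant form of the Cauchy-Schwarz inequality.\<close>
lemma square_le_of_quadratic_nonneg:
  fixes E L m :: real
  assumes "\<And>\<tau>. 0 \<le> E - 2 * \<tau> * L + \<tau>\<^sup>2 * m" "0 \<le> m"
  shows "L\<^sup>2 \<le> m * E"
proof (cases "m = 0")
  case True
  have "L = 0"
  proof (rule ccontr)
    assume "L \<noteq> 0"
    then show False using assms(1)[of "(E + 1) / (2 * L)"] True by (simp add: field_simps)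
  qed
  then show ?thesis using True by simp
next
  case False
  then have "0 \<le> m * (E - 2 * (L / m) * L + (L / m)\<^sup>2 * m)"
    using assms by (intro mult_nonneg_nonneg)
  also have "\<dots> = m * E - L\<^sup>2"
    using False by (simp add: field_simps power2_eq_square)
  finally show ?thesis by simp
qed

context ball_and_oval
begin

text \<open>The integral of \<open>u / a\<^sup>2\<close> against the arc length element \<open>a \<rho> d\<theta>\<close>; for \<open>u = (h - x \<bullet> e_r)\<^sup>2\<close> it is
  \<open>moment x\<close>.\<close>
definition "wint u = integral {0..2*pi} (\<lambda>\<theta>. u \<theta> / a \<theta> * \<rho> \<theta>)"

text \<open>The integral of \<open>k\<^sup>2\<close> against arc length, with \<open>k = \<sigma> / \<rho>\<close> and \<open>ds = a \<rho> d\<theta>\<close>.\<close>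
definition "energy = integral {0..2*pi} (\<lambda>\<theta>. a \<theta> * (\<sigma> \<theta>)\<^sup>2 / \<rho> \<theta>)"

lemma \<rho>_neq0 [simp]: "\<rho> \<theta> \<noteq> 0"
  using pos[of \<theta>] by simp

lemma wint_has_integral:
  assumes "continuous_on UNIV u"
  shows "((\<lambda>\<theta>. u \<theta> / a \<theta> * \<rho> \<theta>) has_integral wint u) {0..2*pi}"
  unfolding wint_def
  by (intro integrable_integral integrable_continuous_interval continuous_intros
      continuous_on_subset[OF assms] P.h_continuous \<rho>_continuous) auto

lemma wint_eq_mixed_form:
  assumes "\<And>\<theta>. (u has_real_derivative u1 \<theta>) (at \<theta>)" "continuous_on UNIV u1" "u (2*pi) = u 0"
  shows "mixed_form (\<lambda>\<theta>. u \<theta> / a \<theta>) h = wint u"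
  unfolding wint_def
proof (rule mixed_form_h)
  show "((\<lambda>\<theta>. u \<theta> / a \<theta>) has_real_derivative (u1 \<theta> * a \<theta> - u \<theta> * a1 \<theta>) / (a \<theta> * a \<theta>)) (at \<theta>)" for \<theta>
    by (rule DERIV_divide[OF assms(1) P.h_deriv]) simp
  show "continuous_on UNIV (\<lambda>\<theta>. (u1 \<theta> * a \<theta> - u \<theta> * a1 \<theta>) / (a \<theta> * a \<theta>))"
    by (intro continuous_intros assms(2) continuous_on_deriv[OF assms(1)] P.h_continuous P.h1_continuous) auto
  show "u (2*pi) / a (2*pi) = u 0 / a 0"
    using P.h_periodic[of 0] assms(3) by simp
qed

lemma mixed_form_eqs:
  shows "mixed_form a a / 2 = ball_area" "mixed_form a h = len" "mixed_form h h / 2 = area"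
    and "mixed_form h a = len"
proof -
  have p: "a (2*pi) = a 0" "h (2*pi) = h 0" using P.h_periodic[of 0] h_periodic[of 0] by simp_all
  show "mixed_form a a / 2 = ball_area"
    using P.mixed_form_h[OF P.h_deriv P.h1_continuous p(1)] by (simp add: ball_area_def)
  show "mixed_form a h = len"
    using mixed_form_h[OF P.h_deriv P.h1_continuous p(1)] by (simp add: len_def)
  moreover have "mixed_form h a = mixed_form a h" by (simp add: mixed_form_def mult.commute)
  ultimately show "mixed_form h a = len" by simp
  show "mixed_form h h / 2 = area"
    using mixed_form_h[OF h_deriv h1_continuous p(2)] by (simp add: area_def)
qed

lemma wint_mixed_forms:
  "mixed_form (\<lambda>\<theta>. (h \<theta>)\<^sup>2 / a \<theta>) h = wint (\<lambda>\<theta>. (h \<theta>)\<^sup>2)"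
  "mixed_form (\<lambda>\<theta>. h \<theta> * cos \<theta> / a \<theta>) h = wint (\<lambda>\<theta>. h \<theta> * cos \<theta>)"
  "mixed_form (\<lambda>\<theta>. h \<theta> * sin \<theta> / a \<theta>) h = wint (\<lambda>\<theta>. h \<theta> * sin \<theta>)"
  "mixed_form (\<lambda>\<theta>. (cos \<theta>)\<^sup>2 / a \<theta>) h = wint (\<lambda>\<theta>. (cos \<theta>)\<^sup>2)"
  "mixed_form (\<lambda>\<theta>. cos \<theta> * sin \<theta> / a \<theta>) h = wint (\<lambda>\<theta>. cos \<theta> * sin \<theta>)"
  "mixed_form (\<lambda>\<theta>. (sin \<theta>)\<^sup>2 / a \<theta>) h = wint (\<lambda>\<theta>. (sin \<theta>)\<^sup>2)"
proof -
  have p: "h (2*pi) = h 0" using h_periodic[of 0] by simp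
  show "mixed_form (\<lambda>\<theta>. (h \<theta>)\<^sup>2 / a \<theta>) h = wint (\<lambda>\<theta>. (h \<theta>)\<^sup>2)"
    by (rule wint_eq_mixed_form[where ?u1.0 = "\<lambda>\<theta>. 2 * h \<theta> * h1 \<theta>"])
      (auto intro!: derivative_eq_intros h_deriv continuous_intros h_continuous h1_continuous simp: p)
  show "mixed_form (\<lambda>\<theta>. h \<theta> * cos \<theta> / a \<theta>) h = wint (\<lambda>\<theta>. h \<theta> * cos \<theta>)"
    by (rule wint_eq_mixed_form[where ?u1.0 = "\<lambda>\<theta>. h1 \<theta> * cos \<theta> - h \<theta> * sin \<theta>"])
      (auto intro!: derivative_eq_intros h_deriv continuous_intros h_continuous h1_continuous simp: p)
  show "mixed_form (\<lambda>\<theta>. h \<theta> * sin \<theta> / a \<theta>) h = wint (\<lambda>\<theta>. h \<theta> * sin \<theta>)"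
    by (rule wint_eq_mixed_form[where ?u1.0 = "\<lambda>\<theta>. h1 \<theta> * sin \<theta> + h \<theta> * cos \<theta>"])
      (auto intro!: derivative_eq_intros h_deriv continuous_intros h_continuous h1_continuous simp: p)
  show "mixed_form (\<lambda>\<theta>. (cos \<theta>)\<^sup>2 / a \<theta>) h = wint (\<lambda>\<theta>. (cos \<theta>)\<^sup>2)"
    by (rule wint_eq_mixed_form[where ?u1.0 = "\<lambda>\<theta>. - 2 * cos \<theta> * sin \<theta>"])
      (auto intro!: derivative_eq_intros continuous_intros)
  show "mixed_form (\<lambda>\<theta>. cos \<theta> * sin \<theta> / a \<theta>) h = wint (\<lambda>\<theta>. cos \<theta> * sin \<theta>)"
    by (rule wint_eq_mixed_form[where ?u1.0 = "\<lambda>\<theta>. cos \<theta> * cos \<theta> - sin \<theta> * sin \<theta>"])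
      (auto intro!: derivative_eq_intros continuous_intros)
  show "mixed_form (\<lambda>\<theta>. (sin \<theta>)\<^sup>2 / a \<theta>) h = wint (\<lambda>\<theta>. (sin \<theta>)\<^sup>2)"
    by (rule wint_eq_mixed_form[where ?u1.0 = "\<lambda>\<theta>. 2 * sin \<theta> * cos \<theta>"])
      (auto intro!: derivative_eq_intros continuous_intros)
qed

lemma moment_eq:
  "moment x = wint (\<lambda>\<theta>. (h \<theta>)\<^sup>2)
     - 2 * (x $ 1 * wint (\<lambda>\<theta>. h \<theta> * cos \<theta>) + x $ 2 * wint (\<lambda>\<theta>. h \<theta> * sin \<theta>))
     + ((x $ 1)\<^sup>2 * wint (\<lambda>\<theta>. (cos \<theta>)\<^sup>2) + 2 * x $ 1 * x $ 2 * wint (\<lambda>\<theta>. cos \<theta> * sin \<theta>)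
        + (x $ 2)\<^sup>2 * wint (\<lambda>\<theta>. (sin \<theta>)\<^sup>2))" (is "_ = ?r")
proof -
  let ?w = "\<lambda>u \<theta>. u \<theta> / a \<theta> * \<rho> \<theta>"
  have "((\<lambda>\<theta>. ?w (\<lambda>\<theta>. (h \<theta>)\<^sup>2) \<theta> - 2 * (x $ 1 * ?w (\<lambda>\<theta>. h \<theta> * cos \<theta>) \<theta> + x $ 2 * ?w (\<lambda>\<theta>. h \<theta> * sin \<theta>) \<theta>)
     + ((x $ 1)\<^sup>2 * ?w (\<lambda>\<theta>. (cos \<theta>)\<^sup>2) \<theta> + 2 * x $ 1 * x $ 2 * ?w (\<lambda>\<theta>. cos \<theta> * sin \<theta>) \<theta>
        + (x $ 2)\<^sup>2 * ?w (\<lambda>\<theta>. (sin \<theta>)\<^sup>2) \<theta>)) has_integral ?r) {0..2*pi}"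
    by (intro has_integral_add has_integral_diff has_integral_mult_right wint_has_integral
        continuous_intros h_continuous)
  moreover have "(\<lambda>\<theta>. ?w (\<lambda>\<theta>. (h \<theta>)\<^sup>2) \<theta> - 2 * (x $ 1 * ?w (\<lambda>\<theta>. h \<theta> * cos \<theta>) \<theta> + x $ 2 * ?w (\<lambda>\<theta>. h \<theta> * sin \<theta>) \<theta>)
     + ((x $ 1)\<^sup>2 * ?w (\<lambda>\<theta>. (cos \<theta>)\<^sup>2) \<theta> + 2 * x $ 1 * x $ 2 * ?w (\<lambda>\<theta>. cos \<theta> * sin \<theta>) \<theta>
        + (x $ 2)\<^sup>2 * ?w (\<lambda>\<theta>. (sin \<theta>)\<^sup>2) \<theta>))
     = (\<lambda>\<theta>. (h \<theta> - x \<bullet> e_r \<theta>)\<^sup>2 / a \<theta> * \<rho> \<theta>)"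
    by (auto simp: inner_real2 field_simps power2_eq_square)
  ultimately show ?thesis unfolding moment_def by (simp add: integral_unique)
qed

text \<open>The form equals \<open>\<integral> (x cos \<theta> + y sin \<theta>)\<^sup>2 \<rho> / a\<close>; if it vanished, the continuous integrand would vanish
  at the angles \<open>0\<close> and \<open>pi / 2\<close>.\<close>
lemma direction_form_pos:
  assumes "x \<noteq> 0 \<or> y \<noteq> 0"
  shows "x\<^sup>2 * wint (\<lambda>\<theta>. (cos \<theta>)\<^sup>2) + 2 * x * y * wint (\<lambda>\<theta>. cos \<theta> * sin \<theta>)
        + y\<^sup>2 * wint (\<lambda>\<theta>. (sin \<theta>)\<^sup>2) > 0" (is "?q > 0")
proof -
  let ?f = "\<lambda>\<theta>. (x * cos \<theta> + y * sin \<theta>)\<^sup>2 / a \<theta> * \<rho> \<theta>"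
  let ?w = "\<lambda>u \<theta>. u \<theta> / a \<theta> * \<rho> \<theta>"
  have "((\<lambda>\<theta>. x\<^sup>2 * ?w (\<lambda>\<theta>. (cos \<theta>)\<^sup>2) \<theta> + 2 * x * y * ?w (\<lambda>\<theta>. cos \<theta> * sin \<theta>) \<theta>
        + y\<^sup>2 * ?w (\<lambda>\<theta>. (sin \<theta>)\<^sup>2) \<theta>) has_integral ?q) {0..2*pi}"
    by (intro has_integral_add has_integral_mult_right wint_has_integral continuous_intros)
  moreover have "(\<lambda>\<theta>. x\<^sup>2 * ?w (\<lambda>\<theta>. (cos \<theta>)\<^sup>2) \<theta> + 2 * x * y * ?w (\<lambda>\<theta>. cos \<theta> * sin \<theta>) \<theta>
        + y\<^sup>2 * ?w (\<lambda>\<theta>. (sin \<theta>)\<^sup>2) \<theta>) = ?f"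
    by (auto simp: field_simps power2_eq_square)
  ultimately have q: "?q = integral {0..2*pi} ?f" by (simp add: integral_unique)
  have cont: "continuous_on {0..2*pi} ?f"
    by (intro continuous_intros P.h_continuous \<rho>_continuous) auto
  have nonneg: "?f \<theta> \<ge> 0" for \<theta> using a_pos[of \<theta>] pos[of \<theta>] by simp
  have "?q \<noteq> 0"
  proof
    assume "?q = 0"
    then have "?f \<theta> = 0" if "\<theta> \<in> {0..2*pi}" for \<theta>
      using integral_eq_0_iff[OF cont _ nonneg] q that by auto
    from this[of 0] this[of "pi/2"] show False using assms by simp
  qed
  moreover have "?q \<ge> 0"
    unfolding q by (rule integral_nonneg[OF integrable_continuous_interval[OF cont] nonneg])
  ultimately show ?thesis by simp
qed

lemma gram_det_pos:
  "wint (\<lambda>\<theta>. (cos \<theta>)\<^sup>2) * wint (\<lambda>\<theta>. (sin \<theta>)\<^sup>2) - (wint (\<lambda>\<theta>. cos \<theta> * sin \<theta>))\<^sup>2 > 0"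
proof -
  define A B C where "A = wint (\<lambda>\<theta>. (cos \<theta>)\<^sup>2)" and "B = wint (\<lambda>\<theta>. cos \<theta> * sin \<theta>)"
    and "C = wint (\<lambda>\<theta>. (sin \<theta>)\<^sup>2)"
  have "C > 0" using direction_form_pos[of 0 1] by (simp add: C_def)
  moreover have "C\<^sup>2 * A + 2 * C * (- B) * B + (- B)\<^sup>2 * C > 0"
    using direction_form_pos[of C "-B"] \<open>C > 0\<close> by (simp add: A_def B_def C_def)
  then have "C * (A * C - B\<^sup>2) > 0" by (simp add: algebra_simps power2_eq_square)
  ultimately show ?thesis by (simp add: A_def B_def C_def zero_less_mult_iff)
qed

text \<open>With the solution \<open>(u, v)\<close> of the normal equations, completing the square shows that \<open>moment x\<close>
  exceeds \<open>least_moment wint h\<close> by the positive form at \<open>(x $ 1 - u, x $ 2 - v)\<close>.\<close>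
lemma least_moment_le: "least_moment wint h \<le> moment x"
  and least_moment_attained: "\<exists>x. moment x = least_moment wint h"
proof -
  define A B C where "A = wint (\<lambda>\<theta>. (cos \<theta>)\<^sup>2)" and "B = wint (\<lambda>\<theta>. cos \<theta> * sin \<theta>)"
    and "C = wint (\<lambda>\<theta>. (sin \<theta>)\<^sup>2)"
  define \<alpha> \<beta> \<gamma> where "\<alpha> = wint (\<lambda>\<theta>. (h \<theta>)\<^sup>2)" and "\<beta> = wint (\<lambda>\<theta>. h \<theta> * cos \<theta>)"
    and "\<gamma> = wint (\<lambda>\<theta>. h \<theta> * sin \<theta>)"
  define D where "D = A * C - B\<^sup>2"
  define u v where "u = (C * \<beta> - B * \<gamma>) / D" and "v = (A * \<gamma> - B * \<beta>) / D"
  have D: "D > 0" using gram_det_pos by (simp add: D_def A_def B_def C_def)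
  have norm1: "A * u + B * v = \<beta>" and norm2: "B * u + C * v = \<gamma>"
  proof -
    have "A * u + B * v = (\<beta> * D) / D" "B * u + C * v = (\<gamma> * D) / D"
      by (simp_all add: u_def v_def D_def algebra_simps power2_eq_square flip: add_divide_distrib)
    then show "A * u + B * v = \<beta>" "B * u + C * v = \<gamma>" using D by simp_all
  qed
  have "least_moment wint h = \<alpha> - (C * \<beta>\<^sup>2 - 2 * B * \<beta> * \<gamma> + A * \<gamma>\<^sup>2) / D"
    by (simp add: least_moment_def A_def B_def C_def \<alpha>_def \<beta>_def \<gamma>_def D_def)
  also have "(C * \<beta>\<^sup>2 - 2 * B * \<beta> * \<gamma> + A * \<gamma>\<^sup>2) / D = u * \<beta> + v * \<gamma>"
    by (simp add: u_def v_def algebra_simps power2_eq_square flip: add_divide_distrib diff_divide_distrib)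
  finally have least: "least_moment wint h = \<alpha> - (u * \<beta> + v * \<gamma>)" .
  have diff: "moment x = least_moment wint h
      + ((x $ 1 - u)\<^sup>2 * A + 2 * (x $ 1 - u) * (x $ 2 - v) * B + (x $ 2 - v)\<^sup>2 * C)" for x
    unfolding least moment_eq A_def[symmetric] B_def[symmetric] C_def[symmetric]
      \<alpha>_def[symmetric] \<beta>_def[symmetric] \<gamma>_def[symmetric] norm1[symmetric] norm2[symmetric]
    by (simp add: algebra_simps power2_eq_square)
  show "least_moment wint h \<le> moment x"
    using direction_form_pos[of "x $ 1 - u" "x $ 2 - v"] diff[of x]
    by (cases "x $ 1 - u \<noteq> 0 \<or> x $ 2 - v \<noteq> 0") (auto simp: A_def B_def C_def)
  have "moment (vector [u, v]) = least_moment wint h" by (simp add: diff)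
  then show "\<exists>x. moment x = least_moment wint h" ..
qed

text \<open>Cauchy-Schwarz with respect to arc length for the curvature \<open>\<sigma> / \<rho>\<close> and the relative support
  function \<open>(h - x \<bullet> e_r) / a\<close>, whose product has integral \<open>\<integral> (h - x \<bullet> e_r) \<sigma> = len\<close> for every \<open>x\<close>.\<close>
lemma len_sq_le: "len\<^sup>2 \<le> moment x * energy"
proof (rule square_le_of_quadratic_nonneg)
  let ?f = "\<lambda>\<theta>. h \<theta> - x \<bullet> e_r \<theta>"
  have fc: "continuous_on S ?f" for S by (intro continuous_intros h_continuous e_r_continuous)
  have len: "((\<lambda>\<theta>. ?f \<theta> * \<sigma> \<theta>) has_integral len) {0..2*pi}"
  proof -
    have "integral {0..2*pi} (\<lambda>\<theta>. h \<theta> * \<sigma> \<theta>) = len"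
      using P.mixed_form_h[OF h_deriv h1_continuous] h_periodic[of 0] mixed_form_eqs(4) by simp
    then have "((\<lambda>\<theta>. h \<theta> * \<sigma> \<theta>) has_integral len) {0..2*pi}"
      by (metis integrable_integral integrable_continuous_interval continuous_on_mult h_continuous P.\<rho>_continuous)
    then have "((\<lambda>\<theta>. h \<theta> * \<sigma> \<theta> - (x \<bullet> e_r \<theta>) * \<sigma> \<theta>) has_integral len - 0) {0..2*pi}"
      by (intro has_integral_diff P.has_integral_e_r_period)
    then show ?thesis by (simp add: left_diff_distrib)
  qed
  have E: "((\<lambda>\<theta>. a \<theta> * (\<sigma> \<theta>)\<^sup>2 / \<rho> \<theta>) has_integral energy) {0..2*pi}"
    unfolding energy_def
    by (intro integrable_integral integrable_continuous_interval continuous_intros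
        P.h_continuous P.\<rho>_continuous \<rho>_continuous) auto
  have M: "((\<lambda>\<theta>. (?f \<theta>)\<^sup>2 / a \<theta> * \<rho> \<theta>) has_integral moment x) {0..2*pi}"
    unfolding moment_def
    by (intro integrable_integral integrable_continuous_interval continuous_intros
        fc P.h_continuous \<rho>_continuous) auto
  show "0 \<le> moment x"
    using a_pos pos by (intro has_integral_nonneg[OF M]) (simp add: less_imp_le)
  fix \<tau> :: real
  let ?g = "\<lambda>\<theta>. a \<theta> * (\<sigma> \<theta>)\<^sup>2 / \<rho> \<theta> - 2 * \<tau> * (?f \<theta> * \<sigma> \<theta>) + \<tau>\<^sup>2 * ((?f \<theta>)\<^sup>2 / a \<theta> * \<rho> \<theta>)"
  have int: "(?g has_integral energy - 2 * \<tau> * len + \<tau>\<^sup>2 * moment x) {0..2*pi}"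
    by (intro has_integral_add has_integral_diff has_integral_mult_right len E M)
  have "?g \<theta> = a \<theta> * \<rho> \<theta> * (\<sigma> \<theta> / \<rho> \<theta> - \<tau> * ?f \<theta> / a \<theta>)\<^sup>2" for \<theta>
    by (simp add: field_simps power2_eq_square)
  moreover have "a \<theta> * \<rho> \<theta> * (\<sigma> \<theta> / \<rho> \<theta> - \<tau> * ?f \<theta> / a \<theta>)\<^sup>2 \<ge> 0" for \<theta>
    using a_pos[of \<theta>] pos[of \<theta>] by simp
  ultimately show "0 \<le> energy - 2 * \<tau> * len + \<tau>\<^sup>2 * moment x"
    by (intro has_integral_nonneg[OF int]) simp
qed

lemma area_pos: "area > 0"
proof -
  obtain x where x: "ball_area * moment x \<le> len * area" by (rule gage_inequality)
  have "moment x \<noteq> 0" using len_sq_le[of x] len_pos by auto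
  moreover have "moment x \<ge> 0"
    unfolding moment_def
  proof (rule integral_nonneg)
    show "(\<lambda>\<theta>. (h \<theta> - x \<bullet> e_r \<theta>)\<^sup>2 / a \<theta> * \<rho> \<theta>) integrable_on {0..2*pi}"
      by (intro integrable_continuous_interval continuous_intros h_continuous e_r_continuous
          P.h_continuous \<rho>_continuous) auto
  qed (use a_pos pos in \<open>simp add: less_imp_le\<close>)
  ultimately have "ball_area * moment x > 0" using ball_area_pos by simp
  then have "len * area > 0" using x by simp
  then show ?thesis using len_pos by (simp add: zero_less_mult_iff)
qed

definition "defect = 1 - ball_area * least_moment wint h / (len * area)"

lemma defect_nonneg: "defect \<ge> 0"
proof -
  obtain x where "ball_area * moment x \<le> len * area" by (rule gage_inequality)
  moreover have "ball_area * least_moment wint h \<le> ball_area * moment x"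
    using ball_area_pos by (intro mult_left_mono least_moment_le) simp
  ultimately show ?thesis using len_pos area_pos by (simp add: defect_def)
qed

lemma defect_inequality: "(1 - defect) * energy - ball_area * (len / area) \<ge> 0"
proof -
  have "len\<^sup>2 \<le> least_moment wint h * energy" using least_moment_attained len_sq_le by metis
  then have "0 \<le> ball_area / (len * area) * (least_moment wint h * energy - len\<^sup>2)"
    using ball_area_pos len_pos area_pos by (intro mult_nonneg_nonneg) auto
  also have "\<dots> = (1 - defect) * energy - ball_area * (len / area)"
    using len_pos area_pos by (simp add: defect_def field_simps power2_eq_square)
  finally show ?thesis .
qed

lemma homothetic_if_defect_0:
  assumes "defect = 0"
  shows "\<exists>x. \<exists>r>0. \<forall>\<theta>. c \<theta> = x + r *\<^sub>R p \<theta>"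
proof -
  obtain x where x: "ball_area * moment x \<le> len * area"
      "ball_area * moment x = len * area \<Longrightarrow> \<exists>r>0. \<forall>\<theta>. c \<theta> = x + r *\<^sub>R p \<theta>"
    using gage_inequality by blast
  have "ball_area * least_moment wint h \<le> ball_area * moment x"
    using ball_area_pos by (intro mult_left_mono least_moment_le) simp
  moreover have "ball_area * least_moment wint h = len * area"
    using assms len_pos area_pos by (simp add: defect_def field_simps)
  ultimately show ?thesis using x by auto
qed

text \<open>For a translated dilate of the ball the defect inequality reads \<open>- defect * energy \<ge> 0\<close>, while the defect is
  nonnegative.\<close>
lemma defect_0_if_homothetic:
  assumes r: "r > 0" and c: "\<And>\<theta>. c \<theta> = x + r *\<^sub>R p \<theta>"
  shows "defect = 0"
proof -
  have hr: "h \<theta> = x \<bullet> e_r \<theta> + r * a \<theta>" for \<theta>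
    by (simp add: h_def P.h_def c inner_add_left)
  have "\<rho> \<theta> = r * \<sigma> \<theta>" for \<theta>
  proof -
    have "(c has_vector_derivative r *\<^sub>R \<sigma> \<theta> *\<^sub>R e_th \<theta>) (at \<theta>)"
      unfolding c[abs_def] by (auto intro!: derivative_eq_intros P.tangent)
    then have "\<rho> \<theta> *\<^sub>R e_th \<theta> = r *\<^sub>R \<sigma> \<theta> *\<^sub>R e_th \<theta>"
      using tangent vector_derivative_unique_at by blast
    then have "(\<rho> \<theta> *\<^sub>R e_th \<theta>) \<bullet> e_th \<theta> = (r *\<^sub>R \<sigma> \<theta> *\<^sub>R e_th \<theta>) \<bullet> e_th \<theta>"
      by (rule arg_cong)
    then show ?thesis by (simp only: inner_scaleR_left frame_orthonormal mult_1_right)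
  qed
  note \<rho>r = this
  have \<sigma>0: "\<sigma> \<theta> \<noteq> 0" for \<theta> using P.pos[of \<theta>] by simp
  have len: "len = 2 * r * ball_area"
    by (simp add: len_def ball_area_def \<rho>r mult.left_commute[of _ r])
  have area: "area = r\<^sup>2 * ball_area"
  proof -
    have "((\<lambda>\<theta>. (x \<bullet> e_r \<theta>) * \<rho> \<theta> + r\<^sup>2 * (a \<theta> * \<sigma> \<theta>)) has_integral 0 + r\<^sup>2 * (2 * ball_area)) {0..2*pi}"
      unfolding ball_area_def
      by (intro has_integral_add has_integral_e_r_period has_integral_mult_right)
        (auto intro!: integrable_integral integrable_continuous_interval continuous_intros P.h_continuous P.\<rho>_continuous)
    moreover have "(\<lambda>\<theta>. (x \<bullet> e_r \<theta>) * \<rho> \<theta> + r\<^sup>2 * (a \<theta> * \<sigma> \<theta>)) = (\<lambda>\<theta>. h \<theta> * \<rho> \<theta>)"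
      by (auto simp: hr \<rho>r algebra_simps power2_eq_square)
    ultimately show ?thesis by (simp add: area_def integral_unique)
  qed
  have "energy = integral {0..2*pi} (\<lambda>\<theta>. (1 / r) * (a \<theta> * \<sigma> \<theta>))"
    unfolding energy_def using r \<sigma>0 by (intro integral_cong) (simp add: \<rho>r field_simps power2_eq_square)
  then have energy: "energy = 2 * ball_area / r"
    by (simp add: ball_area_def)
  have "(1 - defect) * energy - ball_area * (len / area) = - defect * energy"
    using r ball_area_pos by (simp add: len area energy field_simps power2_eq_square)
  then have "defect * energy \<le> 0" using defect_inequality by simp
  moreover have "energy > 0" using r ball_area_pos by (simp add: energy)
  ultimately have "defect \<le> 0" by (simp add: mult_le_0_iff)
  then show ?thesis using defect_nonneg by simp
qed

lemma isoperimetric_defect_eq: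
  assumes "support_fun P = a" "support_fun \<gamma> = h"
  shows "isoperimetric_defect P \<gamma> = defect"
  unfolding isoperimetric_defect_def Let_def assms mixed_form_eqs defect_def least_moment_def
    wint_mixed_forms ..

lemma scaled:
  assumes "r > 0"
  shows "ball_and_oval (\<lambda>\<theta>. r *\<^sub>R c \<theta>) (\<lambda>\<theta>. r * \<rho> \<theta>) p \<sigma>"
proof (intro ball_and_oval.intro P.oval_axioms ball_and_oval_axioms.intro antipodal)
  show "oval (\<lambda>\<theta>. r *\<^sub>R c \<theta>) (\<lambda>\<theta>. r * \<rho> \<theta>)"
  proof
    show "((\<lambda>\<theta>. r *\<^sub>R c \<theta>) has_vector_derivative (r * \<rho> \<theta>) *\<^sub>R e_th \<theta>) (at \<theta>)" for \<theta>
      by (auto intro!: derivative_eq_intros tangent)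
  qed (use assms periodic pos cont in \<open>auto intro!: continuous_intros\<close>)
qed

text \<open>The least moment and the product of length and area are both homogeneous of degree three.\<close>
lemma defect_scaled:
  assumes r: "r > 0"
  shows "ball_and_oval.defect (\<lambda>\<theta>. r *\<^sub>R c \<theta>) (\<lambda>\<theta>. r * \<rho> \<theta>) p \<sigma> = defect"
proof -
  interpret s: ball_and_oval "\<lambda>\<theta>. r *\<^sub>R c \<theta>" "\<lambda>\<theta>. r * \<rho> \<theta>" p \<sigma> by (rule scaled[OF r])
  have sh: "s.h = (\<lambda>\<theta>. r * h \<theta>)" by (simp add: s.h_def[abs_def] h_def)
  have wint: "s.wint u = r * wint u" for u
    unfolding s.wint_def wint_def integral_mult_right[symmetric] by (simp add: mult_ac)
  have wint_mult: "wint (\<lambda>\<theta>. k * u \<theta>) = k * wint u" for k u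
    unfolding wint_def integral_mult_right[symmetric] by (simp add: mult.assoc)
  have len: "s.len = r * len"
    by (simp add: s.len_def len_def mult.left_commute[of _ r])
  have area: "s.area = r\<^sup>2 * area"
  proof -
    have "(\<lambda>\<theta>. r * h \<theta> * (r * \<rho> \<theta>)) = (\<lambda>\<theta>. r\<^sup>2 * (h \<theta> * \<rho> \<theta>))"
      by (simp add: power2_eq_square mult_ac)
    then show ?thesis by (simp add: s.area_def area_def sh)
  qed
  have "least_moment s.wint s.h = r^3 * least_moment wint h"
    unfolding least_moment_def wint sh power_mult_distrib mult.assoc wint_mult
    using r gram_det_pos by (simp add: field_simps power2_eq_square power3_eq_cube)
  then have "s.defect = 1 - (r^3 * (ball_area * least_moment wint h)) / (r^3 * (len * area))"
    unfolding s.defect_def len area by (simp add: power2_eq_square power3_eq_cube mult_ac)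
  also have "\<dots> = defect" using r by (simp add: defect_def)
  finally show ?thesis .
qed

end

section \<open>Continuity under Hausdorff convergence\<close>

text \<open>Pointwise convergence of functions and derivatives with uniform bounds on one period: weaker than
  convergence in \<open>C\<^sup>1\<close>, but stable under products and sufficient for dominated convergence.\<close>
definition C1_converges :: "(nat \<Rightarrow> real \<Rightarrow> real) \<Rightarrow> (real \<Rightarrow> real) \<Rightarrow> bool" where
  "C1_converges X x \<longleftrightarrow> (\<exists>X' x' B.
     (\<forall>n t. (X n has_real_derivative X' n t) (at t)) \<and> (\<forall>t. (x has_real_derivative x' t) (at t)) \<and>
     (\<forall>n. continuous_on UNIV (X' n)) \<and>
     (\<forall>t. (\<lambda>n. X n t) \<longlonglongrightarrow> x t) \<and> (\<forall>t. (\<lambda>n. X' n t) \<longlonglongrightarrow> x' t) \<and>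
     (\<forall>n. \<forall>t\<in>{0..2*pi}. \<bar>X n t\<bar> \<le> B \<and> \<bar>X' n t\<bar> \<le> B))"

lemma C1_converges_const:
  assumes "\<And>t. (f has_real_derivative f1 t) (at t)" "continuous_on UNIV f1"
  shows "C1_converges (\<lambda>n. f) f"
proof -
  have "bounded (f ` {0..2*pi})" "bounded (f1 ` {0..2*pi})"
    by (auto intro!: compact_imp_bounded compact_continuous_image continuous_on_deriv[OF assms(1)]
        continuous_on_subset[OF assms(2)])
  then obtain B B' where "\<forall>t\<in>{0..2*pi}. \<bar>f t\<bar> \<le> B" "\<forall>t\<in>{0..2*pi}. \<bar>f1 t\<bar> \<le> B'"
    unfolding bounded_iff by auto
  then have "\<forall>t\<in>{0..2*pi}. \<bar>f t\<bar> \<le> max B B' \<and> \<bar>f1 t\<bar> \<le> max B B'"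
    by (auto simp: le_max_iff_disj)
  then show ?thesis
    unfolding C1_converges_def using assms
    by (intro exI[of _ "\<lambda>n. f1"] exI[of _ f1] exI[of _ "max B B'"]) simp
qed

lemma C1_converges_mult:
  assumes "C1_converges X x" "C1_converges Y y"
  shows "C1_converges (\<lambda>n t. X n t * Y n t) (\<lambda>t. x t * y t)"
proof -
  obtain X' x' B where X: "\<And>n t. (X n has_real_derivative X' n t) (at t)"
    "\<And>t. (x has_real_derivative x' t) (at t)" "\<And>n. continuous_on UNIV (X' n)"
    "\<And>t. (\<lambda>n. X n t) \<longlonglongrightarrow> x t" "\<And>t. (\<lambda>n. X' n t) \<longlonglongrightarrow> x' t"
    "\<And>n t. t \<in> {0..2*pi} \<Longrightarrow> \<bar>X n t\<bar> \<le> B" "\<And>n t. t \<in> {0..2*pi} \<Longrightarrow> \<bar>X' n t\<bar> \<le> B"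
    using assms(1) unfolding C1_converges_def by metis
  obtain Y' y' C where Y: "\<And>n t. (Y n has_real_derivative Y' n t) (at t)"
    "\<And>t. (y has_real_derivative y' t) (at t)" "\<And>n. continuous_on UNIV (Y' n)"
    "\<And>t. (\<lambda>n. Y n t) \<longlonglongrightarrow> y t" "\<And>t. (\<lambda>n. Y' n t) \<longlonglongrightarrow> y' t"
    "\<And>n t. t \<in> {0..2*pi} \<Longrightarrow> \<bar>Y n t\<bar> \<le> C" "\<And>n t. t \<in> {0..2*pi} \<Longrightarrow> \<bar>Y' n t\<bar> \<le> C"
    using assms(2) unfolding C1_converges_def by metis
  have B: "B \<ge> 0" "C \<ge> 0" using X(6)[of 0] Y(6)[of 0] by (auto intro: order_trans[OF abs_ge_zero])
  have bd: "\<bar>X n t * Y n t\<bar> \<le> 2 * (B * C)" "\<bar>X' n t * Y n t + Y' n t * X n t\<bar> \<le> 2 * (B * C)"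
    if t: "t \<in> {0..2*pi}" for n t
  proof -
    have "\<bar>X n t * Y n t\<bar> \<le> B * C" "\<bar>X' n t * Y n t\<bar> \<le> B * C" "\<bar>Y' n t * X n t\<bar> \<le> C * B"
      unfolding abs_mult using X(6,7)[OF t] Y(6,7)[OF t] B by (auto intro!: mult_mono)
    moreover have "0 \<le> B * C" using B by simp
    ultimately show "\<bar>X n t * Y n t\<bar> \<le> 2 * (B * C)" "\<bar>X' n t * Y n t + Y' n t * X n t\<bar> \<le> 2 * (B * C)"
      using abs_triangle_ineq[of "X' n t * Y n t" "Y' n t * X n t"] by (auto simp: mult.commute)
  qed
  show ?thesis
    unfolding C1_converges_def
  proof (intro exI conjI allI ballI)
    show "((\<lambda>t. X n t * Y n t) has_real_derivative X' n t * Y n t + Y' n t * X n t) (at t)" for n t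
      by (rule DERIV_mult[OF X(1) Y(1)])
    show "((\<lambda>t. x t * y t) has_real_derivative x' t * y t + y' t * x t) (at t)" for t
      by (rule DERIV_mult[OF X(2) Y(2)])
    show "continuous_on UNIV (\<lambda>t. X' n t * Y n t + Y' n t * X n t)" for n
      by (intro continuous_intros X(3) Y(3) continuous_on_deriv[OF X(1)] continuous_on_deriv[OF Y(1)])
    show "(\<lambda>n. X n t * Y n t) \<longlonglongrightarrow> x t * y t" for t
      by (intro tendsto_intros X Y)
    show "(\<lambda>n. X' n t * Y n t + Y' n t * X n t) \<longlonglongrightarrow> x' t * y t + y' t * x t" for t
      by (intro tendsto_intros X Y)
  qed (use bd in auto)
qed

lemma mixed_form_tendsto:
  assumes "C1_converges X x" "C1_converges Y y"
  shows "(\<lambda>n. mixed_form (X n) (Y n)) \<longlonglongrightarrow> mixed_form x y"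
proof -
  obtain X' x' B where X: "\<And>n t. (X n has_real_derivative X' n t) (at t)"
    "\<And>t. (x has_real_derivative x' t) (at t)" "\<And>n. continuous_on UNIV (X' n)"
    "\<And>t. (\<lambda>n. X n t) \<longlonglongrightarrow> x t" "\<And>t. (\<lambda>n. X' n t) \<longlonglongrightarrow> x' t"
    "\<And>n t. t \<in> {0..2*pi} \<Longrightarrow> \<bar>X n t\<bar> \<le> B" "\<And>n t. t \<in> {0..2*pi} \<Longrightarrow> \<bar>X' n t\<bar> \<le> B"
    using assms(1) unfolding C1_converges_def by metis
  obtain Y' y' C where Y: "\<And>n t. (Y n has_real_derivative Y' n t) (at t)"
    "\<And>t. (y has_real_derivative y' t) (at t)" "\<And>n. continuous_on UNIV (Y' n)"
    "\<And>t. (\<lambda>n. Y n t) \<longlonglongrightarrow> y t" "\<And>t. (\<lambda>n. Y' n t) \<longlonglongrightarrow> y' t"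
    "\<And>n t. t \<in> {0..2*pi} \<Longrightarrow> \<bar>Y n t\<bar> \<le> C" "\<And>n t. t \<in> {0..2*pi} \<Longrightarrow> \<bar>Y' n t\<bar> \<le> C"
    using assms(2) unfolding C1_converges_def by metis
  have B: "B \<ge> 0" "C \<ge> 0" using X(6)[of 0] Y(6)[of 0] by (auto intro: order_trans[OF abs_ge_zero])
  have d: "deriv (X n) = X' n" "deriv x = x'" "deriv (Y n) = Y' n" "deriv y = y'" for n
    using X(1,2) Y(1,2) by (auto intro!: DERIV_imp_deriv)
  show ?thesis
    unfolding mixed_form_def d
  proof (rule dominated_convergence(2)[where h = "\<lambda>t. 2 * (B * C)"])
    show "(\<lambda>t. X n t * Y n t - X' n t * Y' n t) integrable_on {0..2*pi}" for n
      by (intro integrable_continuous_interval continuous_intros continuous_on_deriv[OF X(1)]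
          continuous_on_deriv[OF Y(1)] continuous_on_subset[OF X(3)] continuous_on_subset[OF Y(3)]) auto
    show "(\<lambda>n. X n t * Y n t - X' n t * Y' n t) \<longlonglongrightarrow> x t * y t - x' t * y' t" for t
      by (intro tendsto_intros X Y)
    fix n t assume t: "t \<in> {0..2*pi}"
    have "\<bar>X n t * Y n t\<bar> \<le> B * C" "\<bar>X' n t * Y' n t\<bar> \<le> B * C"
      unfolding abs_mult using X(6,7)[OF t] Y(6,7)[OF t] B by (auto intro!: mult_mono)
    then show "norm (X n t * Y n t - X' n t * Y' n t) \<le> 2 * (B * C)"
      using abs_triangle_ineq4[of "X n t * Y n t" "X' n t * Y' n t"] by simp
  qed auto
qed

lemma tendsto_unique_minimizer:
  fixes f :: "'a::metric_space \<Rightarrow> real"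
  assumes "compact S" "continuous_on S f" "\<And>y. y \<in> S \<Longrightarrow> y \<noteq> x \<Longrightarrow> f x < f y"
    and z: "\<And>n. z n \<in> S" "(\<lambda>n. f (z n)) \<longlonglongrightarrow> f x"
  shows "z \<longlonglongrightarrow> x"
proof (rule metric_LIMSEQ_I)
  fix e :: real assume "e > 0"
  define T where "T = S - ball x e"
  have T: "compact T" "continuous_on T f"
    using assms by (auto simp: T_def intro: compact_diff continuous_on_subset)
  show "\<exists>N. \<forall>n\<ge>N. dist (z n) x < e"
  proof (cases "T = {}")
    case True
    then have "dist (z n) x < e" for n using z(1)[of n] by (auto simp: T_def dist_commute)
    then show ?thesis by blast
  next
    case False
    then obtain y where y: "y \<in> T" "\<And>w. w \<in> T \<Longrightarrow> f y \<le> f w"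
      using continuous_attains_inf[OF T(1) _ T(2)] by blast
    have "y \<noteq> x" "y \<in> S" using y(1) \<open>e > 0\<close> by (auto simp: T_def)
    then have "f x < f y" using assms(3) by blast
    then have "\<forall>\<^sub>F n in sequentially. f (z n) < f y" using z(2) by (rule order_tendstoD(2)[rotated])
    then obtain N where "\<And>n. n \<ge> N \<Longrightarrow> f (z n) < f y" by (auto simp: eventually_sequentially)
    then have "z n \<notin> T" if "n \<ge> N" for n using y(2)[of "z n"] that by fastforce
    then have "dist (z n) x < e" if "n \<ge> N" for n
      using z(1)[of n] that by (auto simp: T_def dist_commute)
    then show ?thesis by blast
  qed
qed

text \<open>Nearby curves have nearby support functions. Choose points \<open>Z n \<theta>\<close> of the limit curve within \<open>d n\<close> of
  \<open>C n \<theta>\<close>; their heights in the direction \<open>e_r \<theta>\<close> tend to the maximum \<open>h \<theta>\<close>, and the maximizer \<open>c \<theta>\<close> is unique,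
  so \<open>C n \<theta>\<close> tends to \<open>c \<theta>\<close>. This controls the derivative \<open>h1 = c \<bullet> e_th\<close> as well.\<close>
lemma C1_converges_support:
  assumes c: "oval c \<rho>" and cn: "\<And>n. oval (C n) (R n)" and d: "d \<longlonglongrightarrow> (0::real)"
    and near: "\<And>n y. y \<in> range (C n) \<Longrightarrow> \<exists>z\<in>range c. dist y z \<le> d n"
    and near': "\<And>n z. z \<in> range c \<Longrightarrow> \<exists>y\<in>range (C n). dist z y \<le> d n"
  shows "C1_converges (\<lambda>n. oval.h (C n)) (oval.h c)"
proof -
  interpret oval c \<rho> by (rule c)
  note hn = oval.h_def[OF cn] and hn1 = oval.h1_def[OF cn]
  have inner_near: "y \<bullet> e_r \<theta> \<le> z \<bullet> e_r \<theta> + e" if "dist y z \<le> e" for y z \<theta> e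
    using norm_cauchy_schwarz[of "y - z" "e_r \<theta>"] that by (simp add: inner_diff_left dist_norm)
  have lower: "h \<theta> - d n \<le> oval.h (C n) \<theta>" for n \<theta>
  proof -
    obtain \<phi> where "dist (c \<theta>) (C n \<phi>) \<le> d n" using near'[of "c \<theta>" n] by auto
    then show ?thesis
      using inner_near[of "c \<theta>" "C n \<phi>" "d n" \<theta>] oval.height_max[OF cn, of n \<phi> \<theta>]
      by (simp add: h_def)
  qed
  have "\<exists>z. z \<in> range c \<and> dist (C n \<theta>) z \<le> d n" for n \<theta>
    using near[of "C n \<theta>" n] by blast
  then obtain Z where Z: "\<And>n \<theta>. Z n \<theta> \<in> range c" "\<And>n \<theta>. dist (C n \<theta>) (Z n \<theta>) \<le> d n"
    by metis
  have Z_le: "Z n \<theta> \<bullet> e_r \<theta> \<le> h \<theta>" for n \<theta> using Z(1)[of n \<theta>] height_max by auto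
  have "compact (range c)"
    using compact_continuous_image[OF c_continuous, of "{0..2*pi}"] range_c by simp
  then have Z_lim: "(\<lambda>n. Z n \<theta>) \<longlonglongrightarrow> c \<theta>" for \<theta>
  proof (rule tendsto_unique_minimizer[where f = "\<lambda>y. - (y \<bullet> e_r \<theta>)"])
    show "continuous_on (range c) (\<lambda>y. - (y \<bullet> e_r \<theta>))" by (intro continuous_intros)
    show "- (c \<theta> \<bullet> e_r \<theta>) < - (y \<bullet> e_r \<theta>)" if y: "y \<in> range c" "y \<noteq> c \<theta>" for y
    proof -
      obtain \<phi> where "y = c \<phi>" using y(1) by auto
      then have "y \<bullet> e_r \<theta> \<le> h \<theta>" "y \<bullet> e_r \<theta> \<noteq> h \<theta>"
        using y(2) height_max[of \<phi> \<theta>] height_max_eq[of \<phi> \<theta>] by auto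
      then show ?thesis by (simp add: h_def)
    qed
    show "Z n \<theta> \<in> range c" for n by (rule Z)
    have Z_ge: "h \<theta> - 2 * d n \<le> Z n \<theta> \<bullet> e_r \<theta>" for n
      using lower[of \<theta> n] inner_near[OF Z(2)[of n \<theta>], of \<theta>] unfolding hn by linarith
    have "(\<lambda>n. h \<theta> - 2 * d n) \<longlonglongrightarrow> h \<theta> - 2 * 0"
      by (intro tendsto_intros d)
    then have "(\<lambda>n. h \<theta> - 2 * d n) \<longlonglongrightarrow> h \<theta>" by simp
    then have "(\<lambda>n. Z n \<theta> \<bullet> e_r \<theta>) \<longlonglongrightarrow> h \<theta>"
      by (rule tendsto_sandwich[rotated 2, OF _ tendsto_const])
        (rule always_eventually, rule allI, rule Z_ge Z_le)+
    then show "(\<lambda>n. - (Z n \<theta> \<bullet> e_r \<theta>)) \<longlonglongrightarrow> - (c \<theta> \<bullet> e_r \<theta>)"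
      by (intro tendsto_minus) (simp add: h_def)
  qed
  have C_lim: "(\<lambda>n. C n \<theta>) \<longlonglongrightarrow> c \<theta>" for \<theta>
  proof -
    have "(\<lambda>n. C n \<theta> - Z n \<theta>) \<longlonglongrightarrow> 0"
      by (rule Lim_null_comparison[OF _ d]) (use Z(2) in \<open>auto simp: dist_norm\<close>)
    from tendsto_add[OF this Z_lim[of \<theta>]] show ?thesis by simp
  qed
  obtain B where B: "\<And>\<theta>. norm (c \<theta>) \<le> B" using bounded_range by (auto simp: bounded_iff)
  obtain K where K: "\<And>n. \<bar>d n\<bar> \<le> K"
    using convergent_imp_Bseq[OF convergentI[OF d]] by (auto simp: Bseq_def)
  have C_bound: "norm (C n \<theta>) \<le> B + K" for n \<theta>
  proof -
    have "norm (Z n \<theta>) \<le> B" using Z(1)[of n \<theta>] B by auto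
    moreover have "norm (C n \<theta> - Z n \<theta>) \<le> K" using Z(2)[of n \<theta>] K[of n] by (simp add: dist_norm)
    ultimately show ?thesis using norm_triangle_sub[of "C n \<theta>" "Z n \<theta>"] by simp
  qed
  show ?thesis
    unfolding C1_converges_def
  proof (intro exI conjI allI ballI)
    show "(oval.h (C n) has_real_derivative oval.h1 (C n) t) (at t)" for n t
      by (rule oval.h_deriv[OF cn])
    show "(h has_real_derivative h1 t) (at t)" for t by (rule h_deriv)
    show "continuous_on UNIV (oval.h1 (C n))" for n by (rule oval.h1_continuous[OF cn])
    show "(\<lambda>n. oval.h (C n) t) \<longlonglongrightarrow> h t" "(\<lambda>n. oval.h1 (C n) t) \<longlonglongrightarrow> h1 t" for t
      unfolding hn hn1 h_def h1_def by (intro tendsto_intros C_lim)+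
    show "\<bar>oval.h (C n) t\<bar> \<le> B + K" for n t
      using Cauchy_Schwarz_ineq2[of "C n t" "e_r t"] C_bound[of n t] by (simp add: hn)
    show "\<bar>oval.h1 (C n) t\<bar> \<le> B + K" for n t
      using Cauchy_Schwarz_ineq2[of "C n t" "e_th t"] C_bound[of n t]
      by (simp add: hn1 norm_eq_sqrt_inner[of "e_th t"])
  qed
qed

text \<open>Every ingredient is a mixed form of products of \<open>H n\<close>, fixed smooth functions and \<open>1 / a\<close>; the
  denominators in the limit are positive.\<close>
lemma (in ball_and_oval) defect_tendsto:
  assumes H: "C1_converges H h" and P: "support_fun P = a" and G: "\<And>n. support_fun (G n) = H n"
    and \<gamma>: "support_fun \<gamma> = h"
  shows "(\<lambda>n. isoperimetric_defect P (G n)) \<longlonglongrightarrow> isoperimetric_defect P \<gamma>"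
proof -
  have a: "C1_converges (\<lambda>n. a) a"
    by (rule C1_converges_const) (rule P.h_deriv P.h1_continuous)+
  have "((\<lambda>t. inverse (a t)) has_real_derivative - (inverse (a t) * a1 t * inverse (a t))) (at t)" for t
    by (rule DERIV_inverse'[OF P.h_deriv]) simp
  then have inv: "C1_converges (\<lambda>n t. inverse (a t)) (\<lambda>t. inverse (a t))"
    by (rule C1_converges_const) (auto intro!: continuous_intros P.h_continuous P.h1_continuous)
  have divide: "C1_converges (\<lambda>n t. X n t / a t) (\<lambda>t. x t / a t)" if "C1_converges X x" for X x
    using C1_converges_mult[OF that inv] by (simp add: divide_inverse)
  have cos: "C1_converges (\<lambda>n. cos) cos" and sin: "C1_converges (\<lambda>n. sin) sin"
    by (rule C1_converges_const, auto intro!: derivative_eq_intros continuous_intros)+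
  note tend = mixed_form_tendsto[OF divide[OF C1_converges_mult] H]
  note lims = tend[OF H H] tend[OF H cos] tend[OF H sin] tend[OF cos cos] tend[OF cos sin] tend[OF sin sin]
    mixed_form_tendsto[OF a H] mixed_form_tendsto[OF H H]
  show ?thesis
    unfolding isoperimetric_defect_def Let_def P G \<gamma> least_moment_def power2_eq_square
    using gram_det_pos len_pos area_pos wint_mixed_forms mixed_form_eqs
    by (intro tendsto_intros lims) (auto simp: power2_eq_square)
qed

lemma (in Metric_space) continuous_map_real_sequentiallyI:
  assumes "\<And>a x. a \<in> M \<Longrightarrow> (\<And>n. x n \<in> M) \<Longrightarrow> (\<lambda>n. d a (x n)) \<longlonglongrightarrow> 0 \<Longrightarrow> (\<lambda>n. f (x n)) \<longlonglongrightarrow> f a"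
  shows "continuous_map mtopology euclideanreal f"
  unfolding mtopology_is_euclidean[symmetric] metric_continuous_map[OF Met_TC.Metric_space_axioms]
proof (intro conjI ballI allI impI)
  fix a and \<epsilon> :: real assume a: "a \<in> M" and "\<epsilon> > 0"
  show "\<exists>\<delta>>0. \<forall>x. x \<in> M \<and> d a x < \<delta> \<longrightarrow> dist (f a) (f x) < \<epsilon>"
  proof (rule ccontr)
    assume "\<not> ?thesis"
    then have "\<exists>x. x \<in> M \<and> d a x < 1 / real (Suc n) \<and> \<not> dist (f a) (f x) < \<epsilon>" for n
      by (metis of_nat_0_less_iff zero_less_Suc zero_less_divide_1_iff)
    then obtain x where x: "\<And>n. x n \<in> M" "\<And>n. d a (x n) < 1 / real (Suc n)"
        "\<And>n. \<not> dist (f a) (f (x n)) < \<epsilon>"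
      by metis
    have "(\<lambda>n. d a (x n)) \<longlonglongrightarrow> 0"
      using x(2) by (intro tendsto_sandwich[OF _ _ tendsto_const LIMSEQ_Suc[OF lim_1_over_n]])
        (auto intro!: always_eventually simp: less_imp_le)
    then have "(\<lambda>n. f (x n)) \<longlonglongrightarrow> f a" by (rule assms[OF a x(1)])
    then obtain N where "dist (f (x N)) (f a) < \<epsilon>"
      using \<open>\<epsilon> > 0\<close> by (metis metric_LIMSEQ_D order_refl)
    then show False using x(3)[of N] by (simp add: dist_commute)
  qed
qed simp

section \<open>Curves in the Minkowski plane\<close>

text \<open>The support function of the set and its derivative give back the parametrization.\<close>
lemma oval_determined_by_range:
  assumes "oval c \<rho>" "oval c' \<rho>'" "range c = range c'"
  shows "c = c'"
proof -
  interpret oval c \<rho> by fact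
  interpret o': oval c' \<rho>' by fact
  have h: "h = o'.h" using support_fun_range o'.support_fun_range assms(3) by simp
  have "h1 \<theta> = o'.h1 \<theta>" for \<theta>
    using DERIV_unique[OF h_deriv o'.h_deriv[folded h]] .
  then show ?thesis by (auto simp: c_frame o'.c_frame h)
qed

lemma support_fun_antipodal:
  assumes "\<And>x. x \<in> P \<Longrightarrow> - x \<in> P"
  shows "support_fun P (\<theta> + pi) = support_fun P \<theta>"
proof -
  have "P = uminus ` P"
    using assms by (auto intro: image_eqI[of _ _ "- x" for x])
  then have "(\<lambda>x. x \<bullet> e_r \<theta>) ` P = (\<lambda>x. x \<bullet> e_r \<theta>) ` uminus ` P" by simp
  then show ?thesis by (simp add: support_fun_def image_image)
qed

text \<open>Differentiability of the support function comes from \<open>a = p \<bullet> e_r\<close>. As \<open>deriv a = p \<bullet> e_th\<close> holds by the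
  definition of \<open>ball_curve\<close>, the derivative of \<open>p\<close> has no component along \<open>e_r\<close>.\<close>
lemma minkowski_ball_oval:
  assumes "minkowski_ball P"
  defines "a \<equiv> support_fun P" and "p \<equiv> ball_curve P"
  defines "\<sigma> \<equiv> \<lambda>\<theta>. a \<theta> + deriv (deriv a) \<theta>"
  shows ball_oval: "ball_and_oval p \<sigma> p \<sigma>"
    and ball_support: "oval.h p = a"
    and ball_curve'_eq: "ball_curve' P \<theta> = \<sigma> \<theta> *\<^sub>R e_th \<theta>"
proof -
  have sym: "\<And>x. x \<in> P \<Longrightarrow> - x \<in> P" and \<sigma>_pos: "\<sigma> \<theta> > 0" for \<theta>
    using assms by (auto simp: minkowski_ball_def \<sigma>_def a_def)
  obtain D where "D 0 = p" and D: "\<And>n t. (D n has_vector_derivative D (Suc n) t) (at t)"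
    using assms by (auto simp: minkowski_ball_def smooth_def p_def)
  then have p: "(p has_vector_derivative D 1 t) (at t)" for t using D[of 0] by simp
  have a: "a = (\<lambda>\<theta>. p \<theta> \<bullet> e_r \<theta>)" and a': "deriv a = (\<lambda>\<theta>. p \<theta> \<bullet> e_th \<theta>)"
    by (simp_all add: p_def a_def ball_curve_def fun_eq_iff inner_add_left)
  have "deriv a \<theta> = p \<theta> \<bullet> e_th \<theta> + D 1 \<theta> \<bullet> e_r \<theta>" for \<theta>
    using has_real_derivative_inner[OF p e_r_deriv] unfolding a by (rule DERIV_imp_deriv)
  then have 0: "D 1 \<theta> \<bullet> e_r \<theta> = 0" for \<theta> by (simp add: a')
  have a_der: "(a has_real_derivative deriv a \<theta>) (at \<theta>)" for \<theta>
  proof -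
    have "(a has_real_derivative p \<theta> \<bullet> e_th \<theta>) (at \<theta>)"
      using has_real_derivative_inner[OF p e_r_deriv, of \<theta>] unfolding a 0 by simp
    then show ?thesis unfolding a' .
  qed
  have "deriv (deriv a) \<theta> = p \<theta> \<bullet> - e_r \<theta> + D 1 \<theta> \<bullet> e_th \<theta>" for \<theta>
    using has_real_derivative_inner[OF p e_th_deriv] unfolding a' by (rule DERIV_imp_deriv)
  then have \<sigma>: "\<sigma> \<theta> = D 1 \<theta> \<bullet> e_th \<theta>" for \<theta> by (simp add: \<sigma>_def a)
  have D1: "D 1 \<theta> = \<sigma> \<theta> *\<^sub>R e_th \<theta>" for \<theta>
    using frame_expansion[of "D 1 \<theta>" \<theta>] unfolding 0 \<sigma>[symmetric] by simp
  then show "ball_curve' P \<theta> = \<sigma> \<theta> *\<^sub>R e_th \<theta>"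
    unfolding ball_curve'_def using vector_derivative_at[OF p[unfolded p_def]] by simp
  have a_anti: "a (\<theta> + pi) = a \<theta>" for \<theta>
    unfolding a_def by (rule support_fun_antipodal) (rule sym)
  have "((\<lambda>t. a (t + pi)) has_real_derivative deriv a (\<theta> + pi)) (at \<theta>)" for \<theta>
    by (subst DERIV_shift[symmetric]) (rule a_der)
  then have "deriv a (\<theta> + pi) = deriv a \<theta>" for \<theta>
    using a_der DERIV_unique unfolding a_anti by blast
  then have anti: "p (\<theta> + pi) = - p \<theta>" for \<theta>
    using a_anti by (simp add: p_def ball_curve_def a_def)
  have oval: "oval p \<sigma>"
  proof
    show "p (\<theta> + 2*pi) = p \<theta>" for \<theta>
      using anti[of \<theta>] anti[of "\<theta> + pi"] by (simp add: add.assoc)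
    show "(p has_vector_derivative \<sigma> \<theta> *\<^sub>R e_th \<theta>) (at \<theta>)" for \<theta>
      using p D1 by simp
    have "continuous_on UNIV (D 1)"
      by (rule continuous_at_imp_continuous_on) (use D has_vector_derivative_continuous in blast)
    then show "continuous_on UNIV \<sigma>"
      unfolding \<sigma>[abs_def] by (intro continuous_intros e_th_continuous)
  qed (rule \<sigma>_pos)
  then show "ball_and_oval p \<sigma> p \<sigma>"
    by (intro ball_and_oval.intro ball_and_oval_axioms.intro anti)
  show "oval.h p = a" unfolding oval.h_def[OF oval] a ..
qed

locale minkowski_plane =
  fixes P :: "(real^2) set"
  assumes ball: "minkowski_ball P"
begin

definition "\<sigma> \<theta> = support_fun P \<theta> + deriv (deriv (support_fun P)) \<theta>"

sublocale B: ball_and_oval "ball_curve P" \<sigma> "ball_curve P" \<sigma>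
  using ball_oval[OF ball] unfolding \<sigma>_def[abs_def] .

lemma support_eq: "support_fun P = B.h"
  using ball_support[OF ball] by simp

lemma ball_curve'_eq: "ball_curve' P \<theta> = \<sigma> \<theta> *\<^sub>R e_th \<theta>"
  using ball_curve'_eq[OF ball] by (simp add: \<sigma>_def)

lemma bracket_eq: "bracket (ball_curve P \<theta>) (ball_curve' P \<theta>) = B.h \<theta> * \<sigma> \<theta>"
  by (simp add: bracket_def det_2 ball_curve'_eq B.h_def inner_real2 algebra_simps)

lemma dual_curve_eq: "dual_curve P \<theta> = (1 / B.h \<theta>) *\<^sub>R e_th \<theta>"
  unfolding dual_curve_def bracket_eq using B.pos[of \<theta>] by (simp add: ball_curve'_eq inverse_eq_divide)

lemma frontier_eq: "frontier P = range (ball_curve P)"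
  using ball B.range_c by (simp add: minkowski_ball_def)

lemma measure_ball: "measure lebesgue P = B.ball_area"
proof -
  have P: "compact P" "strictly_convex P" using ball by (auto simp: minkowski_ball_def)
  then have convex: "convex P"
    unfolding convex_contains_open_segment strictly_convex_def
    using interior_subset by (metis empty_subsetI open_segment_idem subset_trans)
  have bounded: "bounded P" using P compact_imp_bounded by blast
  have "B.region = interior P"
    using inside_frontier_eq_interior[OF bounded convex] B.inside_range by (simp add: frontier_eq)
  then show ?thesis
    using measure_interior[OF bounded negligible_convex_frontier[OF convex]] B.measure_region
    by (simp add: B.ball_area_def)
qed

text \<open>Since the dual curve is \<open>e_th / a\<close>, the angle parametrization is by outer normals, with radius of
  curvature \<open>lam / a\<close>.\<close>
lemma angle_param_oval:
  assumes "angle_param P \<gamma> c lam"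
  shows "ball_and_oval c (\<lambda>\<theta>. lam \<theta> / B.h \<theta>) (ball_curve P) \<sigma>" and "\<gamma> = range c"
proof -
  have per: "c (\<theta> + 2*pi) = c \<theta>" and lam: "lam \<theta> > 0"
    and der: "(c has_vector_derivative (lam \<theta> / B.h \<theta>) *\<^sub>R e_th \<theta>) (at \<theta>)" for \<theta>
    using assms by (auto simp: angle_param_def dual_curve_eq)
  obtain D where D: "D 0 = c" "\<And>n t. (D n has_vector_derivative D (Suc n) t) (at t)"
    using assms by (auto simp: angle_param_def smooth_def)
  have "D 1 \<theta> = (lam \<theta> / B.h \<theta>) *\<^sub>R e_th \<theta>" for \<theta>
    using vector_derivative_unique_at[OF D(2)[of 0 \<theta>, unfolded D(1)] der] by simp
  then have \<rho>: "lam \<theta> / B.h \<theta> = D 1 \<theta> \<bullet> e_th \<theta>" for \<theta> by simp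
  have "continuous_on UNIV (D 1)"
    by (rule continuous_at_imp_continuous_on) (use D(2) has_vector_derivative_continuous in blast)
  then have "continuous_on UNIV (\<lambda>\<theta>. lam \<theta> / B.h \<theta>)"
    unfolding \<rho> by (intro continuous_intros e_th_continuous)
  then have oval: "oval c (\<lambda>\<theta>. lam \<theta> / B.h \<theta>)"
    using per lam der B.a_pos by unfold_locales auto
  then show "ball_and_oval c (\<lambda>\<theta>. lam \<theta> / B.h \<theta>) (ball_curve P) \<sigma>"
    by (intro ball_and_oval.intro B.oval_axioms ball_and_oval_axioms.intro B.antipodal)
  show "\<gamma> = range c"
    using assms oval.range_c[OF oval] by (simp add: angle_param_def)
qed

context
  fixes \<gamma> c lam
  assumes ap: "angle_param P \<gamma> c lam"
begin

interpretation C: ball_and_oval c "\<lambda>\<theta>. lam \<theta> / B.h \<theta>" "ball_curve P" \<sigma>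
  by (rule angle_param_oval[OF ap])

lemma curve_eq_range: "\<gamma> = range c" by (rule angle_param_oval(2)[OF ap])

lemma enclosed_area_eq: "enclosed_area \<gamma> = C.area"
  by (simp add: enclosed_area_def curve_eq_range C.inside_range C.measure_region C.area_def)

lemma Q_length_eq: "Q_length lam = C.len"
  unfolding Q_length_def C.len_def by (rule integral_cong) simp

lemma curvature_energy_eq: "curvature_energy P lam = C.energy"
  unfolding curvature_energy_def C.energy_def mink_curvature_def bracket_eq
proof (rule integral_cong)
  fix \<theta>
  have "lam \<theta> \<noteq> 0" using ap by (metis angle_param_def less_irrefl)
  then show "(B.h \<theta> * \<sigma> \<theta> / lam \<theta>)\<^sup>2 * lam \<theta> = B.h \<theta> * (\<sigma> \<theta>)\<^sup>2 / (lam \<theta> / B.h \<theta>)"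
    by (simp add: field_simps power2_eq_square)
qed

lemma defect_eq: "isoperimetric_defect P \<gamma> = C.defect"
  by (rule C.isoperimetric_defect_eq) (simp_all add: support_eq curve_eq_range C.support_fun_range)

lemma isoperimetric_defect_nonneg: "isoperimetric_defect P \<gamma> \<ge> 0"
  unfolding defect_eq by (rule C.defect_nonneg)

lemma isoperimetric_defect_inequality:
  "(1 - isoperimetric_defect P \<gamma>) * curvature_energy P lam
     - measure lebesgue P * (Q_length lam / enclosed_area \<gamma>) \<ge> 0"
  unfolding defect_eq curvature_energy_eq measure_ball Q_length_eq enclosed_area_eq
  by (rule C.defect_inequality)

lemma isoperimetric_defect_scaled:
  assumes "r > 0"
  shows "isoperimetric_defect P ((\<lambda>x. r *\<^sub>R x) ` \<gamma>) = isoperimetric_defect P \<gamma>"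
proof -
  interpret S: ball_and_oval "\<lambda>\<theta>. r *\<^sub>R c \<theta>" "\<lambda>\<theta>. r * (lam \<theta> / B.h \<theta>)" "ball_curve P" \<sigma>
    by (rule C.scaled[OF assms])
  have "isoperimetric_defect P ((\<lambda>x. r *\<^sub>R x) ` \<gamma>) = S.defect"
    using S.support_fun_range
    by (intro S.isoperimetric_defect_eq) (simp_all add: support_eq curve_eq_range image_image)
  then show ?thesis by (simp only: C.defect_scaled[OF assms] defect_eq)
qed

lemma isoperimetric_defect_eq_0_iff: "isoperimetric_defect P \<gamma> = 0 \<longleftrightarrow> P_circle P \<gamma>"
proof
  assume "isoperimetric_defect P \<gamma> = 0"
  then obtain x r where "r > 0" "\<And>\<theta>. c \<theta> = x + r *\<^sub>R ball_curve P \<theta>"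
    using C.homothetic_if_defect_0 by (auto simp: defect_eq)
  then show "P_circle P \<gamma>"
    by (auto simp: P_circle_def frontier_eq curve_eq_range image_image intro!: exI[of _ x] exI[of _ r])
next
  assume "P_circle P \<gamma>"
  then obtain x r where r: "r > 0" and \<gamma>: "\<gamma> = range (\<lambda>\<theta>. x + r *\<^sub>R ball_curve P \<theta>)"
    by (auto simp: P_circle_def frontier_eq image_image)
  have "oval (\<lambda>\<theta>. r *\<^sub>R ball_curve P \<theta> - (- x)) (\<lambda>\<theta>. r * \<sigma> \<theta>)"
    using B.scaled[OF r] by (intro oval.oval_translate) (simp add: ball_and_oval_def)
  then have "c = (\<lambda>\<theta>. r *\<^sub>R ball_curve P \<theta> - (- x))"
    by (rule oval_determined_by_range[OF C.oval_axioms]) (simp add: \<gamma>[unfolded curve_eq_range] add.commute)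
  then show "isoperimetric_defect P \<gamma> = 0"
    unfolding defect_eq by (intro C.defect_0_if_homothetic[OF r, of x]) (simp add: add.commute)
qed

end

lemma curve_spaceE:
  assumes "\<gamma> \<in> curve_space P"
  obtains c lam where "angle_param P \<gamma> c lam"
  using assms by (auto simp: curve_space_def)

lemma hausdorff_near:
  assumes "S \<in> curve_space P" "T \<in> curve_space P" "y \<in> S"
  shows "\<exists>z\<in>T. dist y z \<le> hausdorff_dist S T"
proof -
  have C: "compact U \<and> U \<noteq> {}" if U: "U \<in> curve_space P" for U
  proof -
    obtain c lam where ap: "angle_param P U c lam" using U by (rule curve_spaceE)
    interpret C: ball_and_oval c "\<lambda>\<theta>. lam \<theta> / B.h \<theta>" "ball_curve P" \<sigma>
      by (rule angle_param_oval[OF ap])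
    show ?thesis
      using compact_continuous_image[OF C.c_continuous, of "{0..2*pi}"] C.range_c curve_eq_range[OF ap] by simp
  qed
  have "infdist y T \<le> hausdorff_dist S T"
    using hausdorff_dist_le_iff[of S T "hausdorff_dist S T"] C[OF assms(1)] C[OF assms(2)] assms(3)
    by (simp add: compact_imp_bounded)
  moreover obtain z where "z \<in> T" "infdist y T = dist y z"
    using infdist_attains_inf[of T y] C[OF assms(2)] compact_imp_closed by blast
  ultimately show ?thesis by auto
qed

lemma isoperimetric_defect_tendsto:
  assumes \<gamma>: "\<gamma> \<in> curve_space P" and G: "\<And>n. G n \<in> curve_space P"
    and lim: "(\<lambda>n. hausdorff_dist \<gamma> (G n)) \<longlonglongrightarrow> 0"
  shows "(\<lambda>n. isoperimetric_defect P (G n)) \<longlonglongrightarrow> isoperimetric_defect P \<gamma>"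
proof -
  interpret M: Metric_space "curve_space P" hausdorff_dist by (rule Metric_space_curve_space)
  obtain c lam where ap: "angle_param P \<gamma> c lam" using \<gamma> by (rule curve_spaceE)
  interpret C: ball_and_oval c "\<lambda>\<theta>. lam \<theta> / B.h \<theta>" "ball_curve P" \<sigma>
    by (rule angle_param_oval[OF ap])
  have "\<exists>c lam. angle_param P (G n) c lam" for n using G[of n] by (auto simp: curve_space_def)
  then obtain cn ln where apn: "\<And>n. angle_param P (G n) (cn n) (ln n)" by metis
  have oval: "oval (cn n) (\<lambda>\<theta>. ln n \<theta> / B.h \<theta>)" for n
    using angle_param_oval(1)[OF apn] by (simp add: ball_and_oval_def)
  show ?thesis
  proof (rule C.defect_tendsto)
    show "C1_converges (\<lambda>n. oval.h (cn n)) C.h"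
    proof (rule C1_converges_support[OF C.oval_axioms oval lim])
      show "\<exists>z\<in>range c. dist y z \<le> hausdorff_dist \<gamma> (G n)" if "y \<in> range (cn n)" for n y
        using hausdorff_near[OF G \<gamma>, of y n] that M.commute[of \<gamma> "G n"]
        by (simp add: curve_eq_range[OF ap] curve_eq_range[OF apn])
      show "\<exists>y\<in>range (cn n). dist z y \<le> hausdorff_dist \<gamma> (G n)" if "z \<in> range c" for n z
        using hausdorff_near[OF \<gamma> G, of z n] that by (simp add: curve_eq_range[OF ap] curve_eq_range[OF apn])
    qed
    show "support_fun P = C.a" by (rule support_eq)
    show "support_fun (G n) = oval.h (cn n)" for n
      unfolding curve_eq_range[OF apn] by (rule oval.support_fun_range[OF oval])
    show "support_fun \<gamma> = C.h"
      unfolding curve_eq_range[OF ap] by (rule C.support_fun_range)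
  qed
qed

end

theorem theorem3p1:
  fixes P :: "(real^2) set"
  assumes "minkowski_ball P"
  shows "\<exists>F :: (real^2) set \<Rightarrow> real.
     (\<forall>\<gamma>\<in>curve_space P. F \<gamma> \<ge> 0) \<and>
     continuous_map (Metric_space.mtopology (curve_space P) hausdorff_dist) euclideanreal F \<and>
     (\<forall>\<gamma>\<in>curve_space P. \<forall>r>0. F ((\<lambda>x. r *\<^sub>R x) ` \<gamma>) = F \<gamma>) \<and>
     (\<forall>\<gamma>\<in>curve_space P. \<forall>c lam. angle_param P \<gamma> c lam \<longrightarrow>
        (1 - F \<gamma>) * curvature_energy P lam
          - measure lebesgue P * (Q_length lam / enclosed_area \<gamma>) \<ge> 0) \<and>
     (\<forall>\<gamma>\<in>curve_space P. F \<gamma> = 0 \<longleftrightarrow> P_circle P \<gamma>)"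
proof (intro exI[of _ "isoperimetric_defect P"] conjI ballI allI impI)
  interpret minkowski_plane P by unfold_locales (rule assms)
  fix \<gamma> assume "\<gamma> \<in> curve_space P"
  then obtain c lam where ap: "angle_param P \<gamma> c lam" by (rule curve_spaceE)
  show "isoperimetric_defect P \<gamma> \<ge> 0" by (rule isoperimetric_defect_nonneg[OF ap])
  show "isoperimetric_defect P \<gamma> = 0 \<longleftrightarrow> P_circle P \<gamma>" by (rule isoperimetric_defect_eq_0_iff[OF ap])
  show "isoperimetric_defect P ((\<lambda>x. r *\<^sub>R x) ` \<gamma>) = isoperimetric_defect P \<gamma>" if "r > 0" for r
    by (rule isoperimetric_defect_scaled[OF ap that])
next
  interpret minkowski_plane P by unfold_locales (rule assms)
  show "(1 - isoperimetric_defect P \<gamma>) * curvature_energy P lam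
          - measure lebesgue P * (Q_length lam / enclosed_area \<gamma>) \<ge> 0"
    if "angle_param P \<gamma> c lam" for \<gamma> c lam
    by (rule isoperimetric_defect_inequality[OF that])
  show "continuous_map (Metric_space.mtopology (curve_space P) hausdorff_dist) euclideanreal
      (isoperimetric_defect P)"
    by (rule Metric_space.continuous_map_real_sequentiallyI[OF Metric_space_curve_space])
      (rule isoperimetric_defect_tendsto)
qed

end
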